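(* Let $\mathcal G=(\mathcal V,\mathcal E,\mathcal W)$ be a finite connected undirected graph without self-loops or multi-edges, with positive edge weights, and let $v_s\neq v_t$ be two vertices such that for every vertex $v$ the shortest path between $v_s$ and $v$ is unique and the shortest path between $v_t$ and $v$ is unique. Then the LARS algorithm, run with input $Q=DW^{-1}$ and $y=y^{(s,t)}$, iteratively builds two shortest-path trees, starting from the roots $v_s$ and $v_t$, and terminates when these two trees connect. That is, there is an index $K\ge 1$ such that: (i) for every $0\le k<K$, the active set is a disjoint union $\mathcal A_k=\mathcal A^{(s)}_k\cup\mathcal A^{(t)}_k$, where $\mathcal A^{(s)}_k$ and $\mathcal A^{(t)}_k$ are the edge sets of trees on disjoint vertex sets $T^{(s)}_k\ni v_s$ and $T^{(t)}_k\ni v_t$, and these are shortest-path trees of $\mathcal G$ rooted at $v_s$ and $v_t$, respectively; (ii) the trees are built by adding edges and never removing any, starting from $\mathcal A_0=\emptyset$, $T_0^{(s)}=\{v_s\}$, $T_0^{(t)}=\{v_t\}$: $\mathcal A_0\subsetneq\mathcal A_1\subsetneq\dots\subsetneq\mathcal A_K$; (iii) the two trees connect at index $K$, i.e. $v_s$ and $v_t$ lie in the same connected component of $(\mathcal V,\mathcal A_K)$, and the algorithm then terminates: $\lambda_K>0$ and $\lambda_{K+1}=0$.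
   Context: **Graph.** $\mathcal V=\{v_1,\dots,v_n\}$, $\mathcal E=\{e_1,\dots,e_m\}$, $\mathcal W=\{w_1,\dots,w_m\}$ with $w_j>0$ the weight of $e_j$, $W=\mathrm{diag}(w_1,\dots,w_m)$. The length of a path is the sum of the weights of its edges; distance is the minimal length of a path. Fix an arbitrary orientation of each edge; the incidence matrix $D\in\mathbb R^{n\times m}$ has $D_{ij}=+1$ if $v_i$ is the tail of $e_j$, $-1$ if $v_i$ is the head of $e_j$, and $0$ otherwise. $y^{(s,t)}\in\mathbb R^n$ has entry $+1$ at $v_s$, $-1$ at $v_t$ and $0$ elsewhere. A tree on a vertex set containing $r$ is a shortest-path tree rooted at $r$ if for each of its vertices $v$ the path in the tree from $r$ to $v$ is a shortest path in $\mathcal G$ (a single vertex is such a tree). Edges are identified with their indices. **LARS algorithm** (for $\min_{\beta\in\mathbb R^m}\frac12\|y-Q\beta\|_2^2+\lambda\|\beta\|_1$ as $\lambda$ decreases from $\infty$ to $0$). $Q_j$ is the $j$th column of $Q$, $Q_{\mathcal A}$ the submatrix of columns indexed by $\mathcal A$, $(\cdot)^+$ the Moore–Penrose pseudoinverse. Start with $k=0$, $\lambda_0=\infty$, $\mathcal A_0=\emptyset$, empty sign vector $s_0$, $a^{(0)}=b^{(0)}=0$. While $\lambda_k>0$, iteration $k$ is as follows. Put $$a^{(k)}=(Q_{\mathcal A_k}^TQ_{\mathcal A_k})^+Q_{\mathcal A_k}^Ty,\qquad b^{(k)}=(Q_{\mathcal A_k}^TQ_{\mathcal A_k})^+s_k,$$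 so that the current segment of the solution path is $\beta_{\mathcal A_k}(\lambda)=a^{(k)}-\lambda b^{(k)}$, $\beta_{\mathcal A_k^c}(\lambda)=0$. - Joining times: for $j\in\mathcal A_k^c$, $$t^{\rm join}_{j,k}=\frac{Q_j^T(Q_{\mathcal A_k}a^{(k)}-y)}{Q_j^TQ_{\mathcal A_k}b^{(k)}\pm1},$$ with the sign $\pm$ chosen so that the value lies in $[0,\lambda_k]$; $\lambda^{\rm join}_{k+1}=\max_{j\in\mathcal A_k^c}t^{\rm join}_{j,k}$. - Crossing times: for $j\in\mathcal A_k$, $t^{\rm cross}_{j,k}=a^{(k)}_j/b^{(k)}_j$ if $0<a^{(k)}_j/b^{(k)}_j<\lambda_k$, and $0$ otherwise; $\lambda^{\rm cross}_{k+1}=\max_{j\in\mathcal A_k}t^{\rm cross}_{j,k}$. (Maxima over empty sets are $0$.) - Next breakpoint: $\lambda_{k+1}=\max\{\lambda^{\rm join}_{k+1},\lambda^{\rm cross}_{k+1}\}$. If $\lambda_{k+1}=0$ the algorithm terminates. Otherwise, if $\lambda_{k+1}=\lambda^{\rm join}_{k+1}$ the joining index $j$ (every index attaining the maximum, in case of ties) is added to the active set and its sign $\mathrm{sign}\big(Q_j^T(y-Q_{\mathcal A_k}\beta_{\mathcal A_k}(\lambda_{k+1}))\big)$ to the sign vector; if $\lambda_{k+1}=\lambda^{\rm cross}_{k+1}$ the crossing index is removed from the active set together with its sign. This gives $\mathcal A_{k+1},s_{k+1}$. *)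

theory Defs
  imports
    "HOL-Analysis.Analysis"
    "Graph_Theory.Digraph_Component"
    "Graph_Theory.Arc_Walk"
    "Graph_Theory.Weighted_Graph"
begin

section \<open>Undirected graphs with indexed edges\<close>

text \<open>
  The maps \<open>et\<close> and \<open>eh\<close> give the tail and the head of each edge in the fixed orientation. As
  usual in this library, an undirected graph is a symmetric digraph: the edge \<open>e\<close> contributes the
  arc \<open>(e, True)\<close> along its orientation and the arc \<open>(e, False)\<close> against it. The library
  predicate \<open>graph\<close> then says that there are neither self-loops nor multi-edges (antiparallel
  oriented edges included), and \<open>strongly_connected\<close> is connectedness.
\<close>

definition ugraph ::
    "('e \<Rightarrow> 'v) \<Rightarrow> ('e \<Rightarrow> 'v) \<Rightarrow> 'v set \<Rightarrow> 'e set \<Rightarrow> ('v, 'e \<times> bool) pre_digraph" where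
  "ugraph et eh V E =
     \<lparr> verts = V, arcs = E \<times> UNIV,
       tail = (\<lambda>(e, fwd). if fwd then et e else eh e),
       head = (\<lambda>(e, fwd). if fwd then eh e else et e) \<rparr>"

definition shortest_path ::
    "('v, 'b) pre_digraph \<Rightarrow> ('b \<Rightarrow> real) \<Rightarrow> 'v \<Rightarrow> 'b list \<Rightarrow> 'v \<Rightarrow> bool" where
  "shortest_path G c u p v \<longleftrightarrow>
     pre_digraph.apath G u p v \<and>
     (\<forall>q. pre_digraph.apath G u q v \<longrightarrow>
        wf_digraph.awalk_cost c p \<le> wf_digraph.awalk_cost c q)"

text \<open>
  The library predicate \<open>tree\<close> only forbids directed cycles, so in a symmetric digraph every edge
  would violate it through the cycle \<open>[(e, True), (e, False)]\<close>. A cycle of the undirected graph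
  is a directed one that does not use an edge twice.
\<close>

definition undirected_tree :: "('v, 'e \<times> bool) pre_digraph \<Rightarrow> bool" where
  "undirected_tree H \<longleftrightarrow>
     strongly_connected H \<and>
     \<not> (\<exists>p. pre_digraph.cycle H p \<and> distinct (map fst p))"

definition shortest_path_tree ::
    "('v, 'e \<times> bool) pre_digraph \<Rightarrow> ('e \<times> bool \<Rightarrow> real) \<Rightarrow> 'v \<Rightarrow>
     ('v, 'e \<times> bool) pre_digraph \<Rightarrow> bool" where
  "shortest_path_tree G c r H \<longleftrightarrow>
     subgraph H G \<and> undirected_tree H \<and> r \<in> verts H \<and>
     (\<forall>v\<in>verts H. \<forall>p. pre_digraph.apath H r p v \<longrightarrow> shortest_path G c r p v)"

definition incidence_matrix ::
    "('e::finite \<Rightarrow> 'v::finite) \<Rightarrow> ('e \<Rightarrow> 'v) \<Rightarrow> real ^ 'e ^ 'v" where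
  "incidence_matrix et eh =
     (\<chi> i j. if i = et j then 1 else if i = eh j then - 1 else 0)"

definition diag_matrix :: "('e::finite \<Rightarrow> real) \<Rightarrow> real ^ 'e ^ 'e" where
  "diag_matrix w = (\<chi> i j. if i = j then w i else 0)"

definition pair_vector :: "'v::finite \<Rightarrow> 'v \<Rightarrow> real ^ 'v" where
  "pair_vector s t = (\<chi> i. if i = s then 1 else if i = t then - 1 else 0)"

section \<open>Moore--Penrose pseudoinverse\<close>

definition is_pinv :: "real ^ 'm ^ 'n \<Rightarrow> real ^ 'n ^ 'm \<Rightarrow> bool" where
  "is_pinv A X \<longleftrightarrow>
     A ** X ** A = A \<and> X ** A ** X = X \<and>
     transpose (A ** X) = A ** X \<and> transpose (X ** A) = X ** A"

definition pinv :: "real ^ 'm ^ 'n \<Rightarrow> real ^ 'n ^ 'm" where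
  "pinv A = (THE X. is_pinv A X)"

lemma is_pinv_unique:
  assumes X: "is_pinv A X" and Y: "is_pinv A Y"
  shows "X = Y"
proof -
  have "A ** X = transpose (A ** Y ** (A ** X))"
    using X Y by (simp add: is_pinv_def matrix_mul_assoc)
  also have "\<dots> = A ** X ** (A ** Y)"
    using X Y by (simp add: is_pinv_def matrix_transpose_mul)
  also have "\<dots> = A ** Y"
    using X by (simp add: is_pinv_def matrix_mul_assoc)
  finally have AX: "A ** X = A ** Y" .
  have "X ** A = transpose (X ** A ** (Y ** A))"
    using X Y by (simp add: is_pinv_def flip: matrix_mul_assoc)
  also have "\<dots> = Y ** A ** (X ** A)"
    using X Y by (simp add: is_pinv_def matrix_transpose_mul)
  also have "\<dots> = Y ** A"
    using X by (simp add: is_pinv_def flip: matrix_mul_assoc)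
  finally have XA: "X ** A = Y ** A" .
  have "X = X ** A ** X" using X by (simp add: is_pinv_def)
  also have "\<dots> = Y ** (A ** X)" by (simp add: XA matrix_mul_assoc)
  also have "\<dots> = Y" using Y by (simp add: AX is_pinv_def matrix_mul_assoc)
  finally show ?thesis .
qed

lemma pinv_eqI: "is_pinv A X \<Longrightarrow> pinv A = X"
  unfolding pinv_def by (blast intro: is_pinv_unique)

section \<open>The LARS algorithm\<close>

text \<open>
  The active set varies, so \<open>Q\<^sub>A\<close> is kept at full size with the columns outside \<open>A\<close> replaced by
  zero, and vectors indexed by \<open>A\<close> are padded with zeros. The Gram matrix is then \<open>Q\<^sub>A\<^sup>T Q\<^sub>A\<close>
  bordered by zeros, and the pseudoinverse of such a matrix is the pseudoinverse of the block
  bordered by zeros; hence all products below are the padded versions of the products of the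
  submatrices.
\<close>

definition active_columns :: "real ^ 'm ^ 'n \<Rightarrow> 'm set \<Rightarrow> real ^ 'm ^ 'n" where
  "active_columns Q A = (\<chi> i j. if j \<in> A then Q $ i $ j else 0)"

definition lars_a :: "real ^ 'm ^ 'n \<Rightarrow> real ^ 'n \<Rightarrow> 'm set \<Rightarrow> real ^ 'm" where
  "lars_a Q y A =
     (let QA = active_columns Q A in pinv (transpose QA ** QA) *v (transpose QA *v y))"

definition lars_b :: "real ^ 'm ^ 'n \<Rightarrow> 'm set \<Rightarrow> real ^ 'm \<Rightarrow> real ^ 'm" where
  "lars_b Q A sg =
     (let QA = active_columns Q A in pinv (transpose QA ** QA) *v sg)"

text \<open>
  A sign \<open>\<sigma>\<close> is admissible if the quotient is defined, i.e.\ its denominator is nonzero, and lies in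
  \<open>[0, \<lambda>]\<close>. If both signs are admissible with different values, the larger value is taken, as the
  first joining event met by decreasing \<open>\<lambda>\<close>. All joining and crossing times are nonnegative, so
  the inserted zeros below only matter for maxima over empty sets.
\<close>

definition join_time ::
    "real ^ 'm ^ 'n \<Rightarrow> real ^ 'n \<Rightarrow> 'm set \<Rightarrow> real ^ 'm \<Rightarrow> ereal \<Rightarrow> 'm \<Rightarrow> real" where
  "join_time Q y A sg l j =
     (let QA = active_columns Q A;
          num = column j Q \<bullet> (QA *v lars_a Q y A - y);
          den = (\<lambda>\<sigma>. column j Q \<bullet> (QA *v lars_b Q A sg) + \<sigma>)
      in Max (insert 0 {num / den \<sigma> | \<sigma>.
           \<sigma> \<in> {1, - 1} \<and> den \<sigma> \<noteq> 0 \<and> 0 \<le> num / den \<sigma> \<and> ereal (num / den \<sigma>) \<le> l}))"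

definition cross_time ::
    "real ^ 'm ^ 'n \<Rightarrow> real ^ 'n \<Rightarrow> 'm set \<Rightarrow> real ^ 'm \<Rightarrow> ereal \<Rightarrow> 'm \<Rightarrow> real" where
  "cross_time Q y A sg l j =
     (let r = lars_a Q y A $ j / lars_b Q A sg $ j
      in if 0 < r \<and> ereal r < l then r else 0)"

record ('m::finite) lars_state =
  lam :: ereal
  active :: "'m set"
  signs :: "real ^ 'm"

definition lars_init :: "'m::finite lars_state" where
  "lars_init = \<lparr> lam = \<infinity>, active = {}, signs = 0 \<rparr>"

text \<open>
  A state with \<open>lam = 0\<close> is terminal. When the next breakpoint is \<open>0\<close>, only \<open>lam\<close> is updated, so
  that the active set and the signs of a terminal state are those of the last iteration.
\<close>

definition lars_step ::
    "real ^ 'm ^ 'n \<Rightarrow> real ^ 'n \<Rightarrow> 'm::finite lars_state \<Rightarrow> 'm lars_state" where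
  "lars_step Q y S =
     (let A = active S; sg = signs S;
          tj = join_time Q y A sg (lam S);
          tc = cross_time Q y A sg (lam S);
          lj = Max (insert 0 (tj ` (- A)));
          lc = Max (insert 0 (tc ` A));
          l = max lj lc;
          J = (if l = lj then {j \<in> - A. tj j = l} else {});
          C = (if l = lc then {j \<in> A. tc j = l} else {});
          \<beta> = lars_a Q y A - l *\<^sub>R lars_b Q A sg
      in if lam S \<le> 0 then S
         else if l = 0 then S\<lparr>lam := 0\<rparr>
         else \<lparr> lam = ereal l,
                active = (A \<union> J) - C,
                signs = (\<chi> j. if j \<in> J then sgn (column j Q \<bullet> (y - active_columns Q A *v \<beta>))
                              else if j \<in> C then 0
                              else sg $ j) \<rparr>)"

definition lars :: "real ^ 'm ^ 'n \<Rightarrow> real ^ 'n \<Rightarrow> nat \<Rightarrow> 'm::finite lars_state" where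
  "lars Q y k = (lars_step Q y ^^ k) lars_init"

end

theory Submission
  imports Defs
begin

text \<open>
  Write \<open>ds\<close> and \<open>dt\<close> for the distances from \<open>s\<close> and \<open>t\<close>. The correlation of the \<open>j\<close>th column
  of \<open>Q\<close> with a residual \<open>r\<close> is the difference of \<open>r\<close> across the edge \<open>j\<close>, divided by the
  weight of \<open>j\<close>. So the condition that no correlation exceeds \<open>\<lambda>\<close> says that \<open>r / \<lambda>\<close> changes by
  at most \<open>w j\<close> across every edge \<open>j\<close>, and the active edges are those across which it changes
  by exactly \<open>w j\<close>, the tight edges. The residuals that occur are \<open>\<lambda>\<close> times a potential \<open>\<phi> v =
  max 0 (a - ds v) - max 0 (b - dt v)\<close>, where the radii \<open>a\<close> and \<open>b\<close> are determined by \<open>\<lambda>\<close>: the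
  residual sums to \<open>1\<close> over the ball of radius \<open>a\<close> around \<open>s\<close> and to \<open>-1\<close> over the ball of
  radius \<open>b\<close> around \<open>t\<close>. As \<open>\<lambda>\<close> decreases, both radii grow, and the algorithm runs Dijkstra's
  algorithm from both roots at once.

  As long as \<open>a + b < ds t\<close>, an edge is tight for \<open>\<phi>\<close> exactly if it lies inside one of the two
  balls and is tight for the distance from the centre (lemma \<open>tight_potential\<close>). Since
  shortest paths are unique, every vertex other than the root has exactly one tight edge
  leading towards the root, so the tight edges inside a ball form a shortest-path tree
  (\<open>ball_shortest_path_tree\<close>). The predicate \<open>breakpoint\<close> records this shape of a state, and
  \<open>lars_step_disconnected\<close> is the induction step. It has three ingredients:

    \<^item> The columns of the active edges are independent, because every nonempty set of such
      edges has a leaf (\<open>columns_independent\<close>). Hence any vector that is supported on the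
      active edges and has the required correlations is the current point of the solution path
      (\<open>lars_segment\<close>), and such vectors can be written down as superpositions of flows along
      shortest paths (\<open>two_sided_flow\<close>).
    \<^item> These flows run away from \<open>s\<close> and towards \<open>t\<close>, both at the beginning of the segment and
      in its continuation to \<open>\<lambda> = 0\<close>. An affine coefficient that has the same sign at both
      ends has no zero in between, so no edge is ever removed (\<open>cross_time_eq_0\<close>).
    \<^item> An inactive edge joins when its difference becomes tight (\<open>join_time_properties\<close>). At
      the first such time the residual over \<open>\<lambda>\<close> is still \<open>1\<close>-Lipschitz for the path metric,
      which forces the new radii to satisfy \<open>a' + b' \<le> ds t\<close> and every vertex outside a ball
      to have at least the new radius as its distance. So the residual is again \<open>\<lambda>\<close> times a
      potential of the above form.

  The active sets increase strictly, hence \<open>a + b = ds t\<close> holds after finitely many steps.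
  Then all edges of the shortest path from \<open>s\<close> to \<open>t\<close> are tight, so the trees are connected
  (\<open>connected_at_meeting\<close>). The unit flow along this path now reproduces \<open>y\<close> exactly, so all
  joining times are \<open>0\<close>, and the sign argument excludes crossings as before
  (\<open>lars_step_connected\<close>).
\<close>

section \<open>One step of the algorithm\<close>

lemma active_columns_mult:
  assumes "\<And>j. j \<notin> A \<Longrightarrow> x $ j = 0"
  shows "active_columns Q A *v x = Q *v x"
  unfolding active_columns_def matrix_vector_mult_def vec_eq_iff
  using assms by (auto intro!: sum.cong)

lemma transpose_active_columns_mult:
  "(transpose (active_columns Q A) *v z) $ j = (if j \<in> A then column j Q \<bullet> z else 0)"
  by (auto simp: transpose_def active_columns_def matrix_vector_mult_def column_def inner_vec_def)

text \<open>
  If the active columns are independent, the bordered Gram matrix becomes invertible when the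
  projection \<open>P\<close> onto the inactive coordinates is added to it. As \<open>P\<close> annihilates the Gram matrix
  from both sides, the pseudoinverse is the inverse of this sum minus \<open>P\<close>; in particular it undoes
  the Gram matrix on vectors that are supported on the active set.
\<close>

lemma pinv_gram:
  fixes Q :: "real ^ 'm::finite ^ 'n::finite"
  defines "gram A \<equiv> transpose (active_columns Q A) ** active_columns Q A"
  assumes indep: "\<And>x. (\<And>j. j \<notin> A \<Longrightarrow> x $ j = 0) \<Longrightarrow> Q *v x = 0 \<Longrightarrow> x = 0"
    and supp: "\<And>j. j \<notin> A \<Longrightarrow> x $ j = 0"
  shows "pinv (gram A) *v (gram A *v x) = x"
proof -
  let ?B = "active_columns Q A"
  define P :: "real ^ 'm ^ 'm" where "P = (\<chi> i j. if i = j then (if i \<in> A then 0 else 1) else 0)"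
  define M where "M = gram A + P"
  have distribs: "Z ** (U + V) = Z ** U + Z ** V" "(U + V) ** Z = U ** Z + V ** Z"
    "Z ** (U - V) = Z ** U - Z ** V" "(U - V) ** Z = U ** Z - V ** Z"
    for Z U V :: "real ^ 'm ^ 'm"
    by (simp_all add: matrix_matrix_mult_def vec_eq_iff algebra_simps sum_subtractf sum.distrib)
  have Pv: "(P *v z) $ i = (if i \<in> A then 0 else z $ i)" for z i
    by (simp add: P_def matrix_vector_mult_def mult_delta_left)
  have BP: "?B ** P = 0"
    unfolding P_def active_columns_def matrix_matrix_mult_def vec_eq_iff
    by (auto intro!: sum.neutral)
  have trP: "transpose P = P"
    by (auto simp: P_def transpose_def vec_eq_iff)
  have GP: "gram A ** P = 0"
    unfolding gram_def matrix_mul_assoc[symmetric] BP by simp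
  have PG: "P ** gram A = 0"
  proof -
    have "P ** gram A = transpose (gram A ** P)"
      unfolding gram_def matrix_transpose_mul transpose_transpose trP ..
    then show ?thesis by (simp add: GP transpose_def vec_eq_iff)
  qed
  have PP: "P ** P = P"
    unfolding matrix_eq matrix_vector_mul_assoc[symmetric] by (simp add: vec_eq_iff Pv)
  have "x = 0" if "M *v x = 0" for x
  proof -
    have G: "gram A *v x = - (P *v x)"
      using that by (simp add: M_def matrix_vector_mult_add_rdistrib eq_neg_iff_add_eq_0)
    have "(gram A *v x) $ i = 0 \<and> (P *v x) $ i = 0" for i
    proof (cases "i \<in> A")
      case True
      then show ?thesis using G Pv[of x i] by simp
    next
      case False
      have "(gram A *v x) $ i = 0"
        using False
        unfolding gram_def matrix_vector_mul_assoc[symmetric] transpose_active_columns_mult by simp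
      moreover have "(gram A *v x) $ i = - ((P *v x) $ i)" by (simp add: G)
      ultimately show ?thesis by simp
    qed
    then have G0: "gram A *v x = 0" and P0: "P *v x = 0" by (auto simp: vec_eq_iff)
    have s: "x $ j = 0" if "j \<notin> A" for j using Pv[of x j] P0 that by simp
    have "(?B *v x) \<bullet> (?B *v x) = x \<bullet> (gram A *v x)"
      unfolding gram_def matrix_vector_mul_assoc[symmetric]
      by (metis dot_lmul_matrix inner_commute transpose_matrix_vector transpose_transpose)
    then have "?B *v x = 0" by (simp add: G0)
    then have "Q *v x = 0" using active_columns_mult[of A x Q] s by simp
    then show "x = 0" using indep s by blast
  qed
  then have "invertible M"
    unfolding invertible_left_inverse matrix_left_invertible_ker by blast
  then obtain N where NM: "N ** M = mat 1" and MN: "M ** N = mat 1"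
    by (auto simp: invertible_def)
  have NP: "N ** P = P"
  proof -
    have "M ** P = P" by (simp add: M_def distribs GP PP)
    then have "N ** P = (N ** M) ** P" unfolding matrix_mul_assoc[symmetric] by simp
    then show ?thesis by (simp add: NM)
  qed
  have PN: "P ** N = P"
  proof -
    have "P ** M = P" by (simp add: M_def distribs PG PP)
    then have "P ** N = P ** (M ** N)" unfolding matrix_mul_assoc by simp
    then show ?thesis by (simp add: MN)
  qed
  define X where "X = N - P"
  have NG: "N ** gram A = mat 1 - P"
    using NM NP by (simp add: M_def distribs eq_diff_eq)
  have GN: "gram A ** N = mat 1 - P"
    using MN PN by (simp add: M_def distribs eq_diff_eq)
  have XG: "X ** gram A = mat 1 - P" by (simp add: X_def distribs NG PG)
  have GX: "gram A ** X = mat 1 - P" by (simp add: X_def distribs GN GP)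
  have tI: "transpose (mat 1 - P) = mat 1 - P"
    by (auto simp: P_def transpose_def vec_eq_iff mat_def)
  have "is_pinv (gram A) X"
    unfolding is_pinv_def XG GX tI
    by (simp add: distribs PG X_def distribs NP PN PP)
  then have "pinv (gram A) = X" by (rule pinv_eqI)
  then have "pinv (gram A) *v (gram A *v x) = x - P *v x"
    by (simp add: matrix_vector_mul_assoc XG matrix_vector_mult_diff_rdistrib)
  also have "\<dots> = x" using supp by (auto simp: vec_eq_iff Pv)
  finally show ?thesis .
qed

text \<open>
  The correlations required on the active set are the normal equations of the segment at \<open>l\<close>, and
  independence makes their solution unique. This allows the pseudoinverse to be avoided
  altogether: a point of the segment is found by guessing a vector with the right correlations.
\<close>

lemma lars_segment:
  fixes Q :: "real ^ 'm::finite ^ 'n::finite"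
  assumes indep: "\<And>x. (\<And>j. j \<notin> A \<Longrightarrow> x $ j = 0) \<Longrightarrow> Q *v x = 0 \<Longrightarrow> x = 0"
    and supp: "\<And>j. j \<notin> A \<Longrightarrow> x $ j = 0" "\<And>j. j \<notin> A \<Longrightarrow> sg $ j = 0"
    and corr: "\<And>j. j \<in> A \<Longrightarrow> column j Q \<bullet> (y - Q *v x) = l * sg $ j"
  shows "lars_a Q y A - l *\<^sub>R lars_b Q A sg = x"
proof -
  let ?B = "active_columns Q A"
  let ?G = "transpose ?B ** ?B"
  have "?G *v x = transpose ?B *v y - l *\<^sub>R sg"
    unfolding vec_eq_iff
  proof
    fix j
    show "(?G *v x) $ j = (transpose ?B *v y - l *\<^sub>R sg) $ j"
      using corr[of j, unfolded inner_diff_right] supp(2)[of j]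
      unfolding matrix_vector_mul_assoc[symmetric] vector_minus_component
        vector_scaleR_component transpose_active_columns_mult
      by (auto simp: active_columns_mult supp(1))
  qed
  then have "pinv ?G *v (transpose ?B *v y - l *\<^sub>R sg) = x"
    using pinv_gram[of A Q x] indep supp by simp
  then show ?thesis
    by (simp add: lars_a_def lars_b_def Let_def matrix_vector_mult_diff_distrib
        matrix_vector_mult_scaleR)
qed

text \<open>
  A coefficient \<open>a - \<lambda> b\<close> that weakly agrees with the sign of \<open>\<sigma>\<close> at \<open>\<lambda> = 0\<close> and at \<open>\<lambda> = l\<close> cannot
  vanish strictly in between, unless it vanishes identically, and then the quotient is \<open>0 / 0 = 0\<close>.
\<close>

lemma cross_time_eq_0:
  assumes "0 \<le> lars_a Q y A $ j * \<sigma>"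
    and "0 \<le> (lars_a Q y A - l *\<^sub>R lars_b Q A sg) $ j * \<sigma>"
    and "\<sigma> \<noteq> 0"
  shows "cross_time Q y A sg (ereal l) j = 0"
proof -
  define a b where "a = lars_a Q y A $ j * \<sigma>" and "b = lars_b Q A sg $ j * \<sigma>"
  have r: "lars_a Q y A $ j / lars_b Q A sg $ j = a / b" using assms(3) by (simp add: a_def b_def)
  have "0 \<le> a" "l * b \<le> a" using assms by (simp_all add: a_def b_def algebra_simps)
  then have "\<not> (0 < a / b \<and> a / b < l)"
    by (auto simp: zero_less_divide_iff pos_divide_less_eq)
  then show ?thesis by (simp add: cross_time_def Let_def r del: divide_eq_0_iff)
qed

text \<open>
  The joining time is the largest point at which the affine correlation \<open>g\<close> meets the diagonal or
  its mirror image. The hypothesis \<open>slack\<close> covers the range from \<open>L\<close> up to the current penalty \<open>l\<close>,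
  which is a single point if \<open>l = L\<close>; the general form also treats the first iteration, where
  \<open>l = \<infinity>\<close> and \<open>L\<close> is any sufficiently large number.
\<close>

lemma join_time_properties:
  fixes Q :: "real ^ 'm::finite ^ 'n::finite"
  defines "g \<equiv> \<lambda>A sg y j \<mu>. column j Q \<bullet>
    (y - active_columns Q A *v (lars_a Q y A - \<mu> *\<^sub>R lars_b Q A sg))"
  assumes "0 < L" "ereal L \<le> l"
    and slack: "\<And>\<mu>. L \<le> \<mu> \<Longrightarrow> ereal \<mu> \<le> l \<Longrightarrow> \<bar>g A sg y j \<mu>\<bar> < \<mu>"
  defines "t \<equiv> join_time Q y A sg l j"
  shows "0 \<le> t" "t < L" "g A sg y j 0 \<noteq> 0 \<Longrightarrow> 0 < t" "0 < t \<Longrightarrow> \<bar>g A sg y j t\<bar> = t"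
    "g A sg y j 0 = 0 \<Longrightarrow> t = 0"
    "\<And>\<mu>. t < \<mu> \<Longrightarrow> \<mu> \<le> L \<Longrightarrow> \<bar>g A sg y j \<mu>\<bar> < \<mu>"
proof -
  define g0 where "g0 = column j Q \<bullet> (y - active_columns Q A *v lars_a Q y A)"
  define g1 where "g1 = column j Q \<bullet> (active_columns Q A *v lars_b Q A sg)"
  have g: "g A sg y j \<mu> = g0 + \<mu> * g1" for \<mu>
    by (simp add: g_def g0_def g1_def matrix_vector_mult_diff_distrib matrix_vector_mult_scaleR
        inner_diff_right)
  define V where "V = {- g0 / (g1 + \<sigma>) | \<sigma>. \<sigma> \<in> {1, - 1} \<and> g1 + \<sigma> \<noteq> 0 \<and>
    0 \<le> - g0 / (g1 + \<sigma>) \<and> ereal (- g0 / (g1 + \<sigma>)) \<le> l}"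
  have num: "column j Q \<bullet> (active_columns Q A *v lars_a Q y A - y) = - g0"
    by (simp add: g0_def inner_diff_right)
  have t: "t = Max (insert 0 V)"
    unfolding t_def join_time_def Let_def num V_def g1_def ..
  have finV: "finite V"
  proof -
    have "V \<subseteq> (\<lambda>\<sigma>. - g0 / (g1 + \<sigma>)) ` {1, -1}" unfolding V_def by auto
    then show ?thesis by (rule finite_subset) simp
  qed
  have V: "x \<in> V \<Longrightarrow> \<bar>g0 + x * g1\<bar> = x \<and> ereal x \<le> l" for x
  proof -
    assume "x \<in> V"
    then obtain \<sigma> where s: "\<sigma> = 1 \<or> \<sigma> = -1" "g1 + \<sigma> \<noteq> 0" and x: "x = - g0 / (g1 + \<sigma>)" "0 \<le> x"
      and l: "ereal x \<le> l"
      unfolding V_def by auto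
    have "x * (g1 + \<sigma>) = - g0" using s x by simp
    then have "g0 + x * g1 = - \<sigma> * x" by (simp add: algebra_simps)
    then have "\<bar>g0 + x * g1\<bar> = x" using s(1) x(2) by auto
    then show ?thesis using l by simp
  qed
  show t0: "0 \<le> t" unfolding t using finV by simp
  have tV: "t = 0 \<or> t \<in> V" unfolding t using finV Max_in[of "insert 0 V"] by auto
  show "t < L"
    using tV V[of t] slack[of t] \<open>0 < L\<close> unfolding g by force
  show "0 < t \<Longrightarrow> \<bar>g A sg y j t\<bar> = t" using tV V unfolding g by auto
  show "g A sg y j 0 = 0 \<Longrightarrow> t = 0"
  proof -
    assume "g A sg y j 0 = 0"
    then have "V \<subseteq> {0}" unfolding g V_def by auto
    then show "t = 0" using tV by auto
  qed
  have L: "\<bar>g0 + L * g1\<bar> < L" using slack[of L] assms unfolding g by simp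
  show tight: "\<bar>g A sg y j \<mu>\<bar> < \<mu>" if \<mu>: "t < \<mu>" "\<mu> \<le> L" for \<mu>
  proof (rule ccontr)
    assume "\<not> ?thesis"
    then have "\<mu> \<le> \<bar>g0 + \<mu> * g1\<bar>" by (simp add: g)
    \<comment> \<open>the correlation has to meet the diagonal between \<open>\<mu>\<close> and \<open>L\<close>\<close>
    then have "\<exists>x\<ge>\<mu>. x \<le> L \<and> x - \<bar>g0 + x * g1\<bar> = 0"
      using \<mu> L by (intro IVT') (auto intro!: continuous_intros)
    then obtain x where x: "\<mu> \<le> x" "x \<le> L" "\<bar>g0 + x * g1\<bar> = x" by force
    obtain \<sigma> :: real where s: "\<sigma> \<in> {1, -1}" "g0 + x * g1 = - \<sigma> * x"
      using x(3) by (cases "0 \<le> g0 + x * g1") force+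
    have eq: "x * (g1 + \<sigma>) = - g0" using s by (simp add: algebra_simps)
    have "g1 + \<sigma> \<noteq> 0"
    proof
      assume "g1 + \<sigma> = 0"
      then have "g0 = 0" "g1 = - \<sigma>" using eq by auto
      then show False using L s \<open>0 < L\<close> by (auto simp: abs_mult)
    qed
    then have "x = - g0 / (g1 + \<sigma>)" using eq by (metis nonzero_eq_divide_eq)
    moreover have "ereal x \<le> l" using x(2) assms(3) by (meson ereal_less_eq(3) order_trans)
    ultimately have "x \<in> V"
      unfolding V_def using s \<open>g1 + \<sigma> \<noteq> 0\<close> x \<mu> t0 by auto
    then have "x \<le> t" unfolding t using finV by simp
    then show False using \<mu> x by simp
  qed
  show "0 < t" if "g A sg y j 0 \<noteq> 0"
  proof (rule ccontr)
    assume "\<not> 0 < t"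
    then have t: "t = 0" using t0 by simp
    \<comment> \<open>small enough that \<open>\<mu> * (1 + \<bar>g1\<bar>) < \<bar>g0\<bar>\<close>, so that \<open>g\<close> still exceeds \<open>\<mu>\<close> at \<open>\<mu>\<close>\<close>
    define \<mu> where "\<mu> = min L (\<bar>g0\<bar> / (2 * (1 + \<bar>g1\<bar>)))"
    have g0: "g0 \<noteq> 0" using that by (simp add: g)
    then have \<mu>: "0 < \<mu>" "\<mu> \<le> L" using \<open>0 < L\<close> by (auto simp: \<mu>_def zero_less_divide_iff)
    have "\<bar>g0 + \<mu> * g1\<bar> < \<mu>" using tight[of \<mu>] \<mu> t by (simp add: g)
    moreover have "\<bar>\<mu> * g1\<bar> = \<mu> * \<bar>g1\<bar>" using \<mu> by (simp add: abs_mult)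
    ultimately have "\<bar>g0\<bar> < \<mu> * (1 + \<bar>g1\<bar>)" by (simp add: algebra_simps abs_if split: if_splits)
    also have "\<dots> \<le> \<bar>g0\<bar> / (2 * (1 + \<bar>g1\<bar>)) * (1 + \<bar>g1\<bar>)"
      by (intro mult_right_mono) (auto simp: \<mu>_def)
    also have "\<dots> = \<bar>g0\<bar> / 2" by (simp add: field_simps add_nonneg_eq_0_iff)
    finally show False by simp
  qed
qed

lemma lars_step_join:
  fixes Q :: "real ^ 'm::finite ^ 'n::finite"
  assumes "0 < lam S"
    and cross: "\<And>j. j \<in> active S \<Longrightarrow> cross_time Q y (active S) (signs S) (lam S) j = 0"
  defines "t \<equiv> join_time Q y (active S) (signs S) (lam S)"
  defines "l \<equiv> Max (insert 0 (t ` (- active S)))"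
  defines "J \<equiv> {j \<in> - active S. t j = l}"
  shows "l = 0 \<Longrightarrow> lars_step Q y S = S\<lparr>lam := 0\<rparr>"
    and "l \<noteq> 0 \<Longrightarrow> lars_step Q y S = \<lparr>lam = ereal l, active = active S \<union> J,
      signs = (\<chi> j. if j \<in> J then sgn (column j Q \<bullet> (y - active_columns Q (active S) *v
        (lars_a Q y (active S) - l *\<^sub>R lars_b Q (active S) (signs S)))) else signs S $ j)\<rparr>"
proof -
  have c: "insert 0 (cross_time Q y (active S) (signs S) (lam S) ` active S) = {0}"
    using cross by auto
  have "0 \<le> l" unfolding l_def by simp
  then have m: "max l (Max {0}) = l" by simp
  have "\<not> lam S \<le> 0" using assms(1) by simp
  then show "l = 0 \<Longrightarrow> lars_step Q y S = S\<lparr>lam := 0\<rparr>"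
    unfolding lars_step_def Let_def c t_def[symmetric] l_def[symmetric] m by simp
  show "lars_step Q y S = \<lparr>lam = ereal l, active = active S \<union> J,
      signs = (\<chi> j. if j \<in> J then sgn (column j Q \<bullet> (y - active_columns Q (active S) *v
        (lars_a Q y (active S) - l *\<^sub>R lars_b Q (active S) (signs S)))) else signs S $ j)\<rparr>" if "l \<noteq> 0"
    using that \<open>\<not> lam S \<le> 0\<close>
    unfolding lars_step_def Let_def c t_def[symmetric] l_def[symmetric] J_def m
    by (simp cong: if_cong)
qed

section \<open>Flows and distances in a weighted network\<close>

lemma matrix_inv_diag:
  assumes "\<And>e. w e \<noteq> (0::real)"
  shows "matrix_inv (diag_matrix w) = diag_matrix (\<lambda>e. inverse (w e))"
proof -
  let ?D = "diag_matrix (\<lambda>e. inverse (w e))"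
  have D: "diag_matrix w ** ?D = mat 1" "?D ** diag_matrix w = mat 1"
    using assms by (simp_all add: diag_matrix_def matrix_matrix_mult_def mat_def vec_eq_iff
        mult_delta_left)
  then have "invertible (diag_matrix w)" by (auto simp: invertible_def)
  then have "matrix_inv (diag_matrix w) ** diag_matrix w = mat 1"
    unfolding invertible_def matrix_inv_def by (rule someI2_ex) simp
  then have "matrix_inv (diag_matrix w) ** (diag_matrix w ** ?D) = ?D"
    unfolding matrix_mul_assoc by simp
  then show ?thesis by (simp add: D)
qed

lemma weighted_incidence_nth:
  assumes "\<And>e. w e \<noteq> (0::real)"
  shows "(incidence_matrix et eh ** matrix_inv (diag_matrix w)) $ i $ j =
    (if i = et j then 1 else if i = eh j then - 1 else 0) / w j"
  unfolding matrix_inv_diag[OF assms]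
  by (simp add: diag_matrix_def matrix_matrix_mult_def incidence_matrix_def
      mult_delta_right divide_inverse)

definition joins :: "('e \<Rightarrow> 'v) \<Rightarrow> ('e \<Rightarrow> 'v) \<Rightarrow> 'e \<Rightarrow> 'v \<Rightarrow> 'v \<Rightarrow> bool" where
  "joins et eh e u v \<longleftrightarrow> u = et e \<and> v = eh e \<or> u = eh e \<and> v = et e"

locale weighted_network =
  fixes et eh :: "'e::finite \<Rightarrow> 'v::finite" and w :: "'e \<Rightarrow> real" and Q :: "real ^ 'e ^ 'v"
  assumes loopfree: "et e \<noteq> eh e"
    and w_pos: "0 < w e"
    and Q_nth: "Q $ i $ j = (if i = et j then 1 else if i = eh j then - 1 else 0) / w j"
begin

abbreviation "ends \<equiv> joins et eh"

lemma ends_sym: "ends e u v \<longleftrightarrow> ends e v u"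
  by (auto simp: joins_def)

lemma ends_endpoints: "ends e (et e) (eh e)" "ends e (eh e) (et e)"
  by (auto simp: joins_def)

lemma column_Q: "column j Q = (1 / w j) *\<^sub>R (axis (et j) 1 - axis (eh j) 1)"
  using loopfree[of j] by (auto simp: column_def vec_eq_iff Q_nth axis_def)

lemma column_inner: "column j Q \<bullet> z = (z $ et j - z $ eh j) / w j"
  by (simp add: column_Q inner_diff_left inner_axis' diff_divide_distrib)

lemma Q_mult_axis: "Q *v axis j c = (c / w j) *\<^sub>R (axis (et j) 1 - axis (eh j) 1)"
proof -
  have "axis j c = c *\<^sub>R (axis j 1 :: real ^ 'e)" by (auto simp: vec_eq_iff axis_def)
  then show ?thesis
    by (simp only: matrix_vector_mult_scaleR matrix_vector_mult_basis column_Q) simp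
qed

text \<open>
  A set of edges each of whose nonempty subsets has a leaf is a forest. A dependency among its
  columns would be a circulation, and no circulation is carried by an edge that is the only
  one of its support at some vertex.
\<close>

lemma forest_columns_independent:
  assumes leaf: "\<And>B. B \<subseteq> A \<Longrightarrow> B \<noteq> {} \<Longrightarrow> \<exists>e\<in>B. \<exists>u v. ends e u v \<and> (\<forall>e'\<in>B. \<forall>z. ends e' v z \<longrightarrow> e' = e)"
    and supp: "\<And>j. j \<notin> A \<Longrightarrow> x $ j = 0"
    and zero: "Q *v x = 0"
  shows "x = 0"
proof (rule ccontr)
  assume "x \<noteq> 0"
  define B where "B = {j. x $ j \<noteq> 0}"
  have "B \<subseteq> A" "B \<noteq> {}" using supp \<open>x \<noteq> 0\<close> by (auto simp: B_def vec_eq_iff)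
  then obtain e u v where e: "e \<in> B" "ends e u v" and
    uniq: "\<And>e' z. e' \<in> B \<Longrightarrow> ends e' v z \<Longrightarrow> e' = e"
    using leaf by meson
  have other: "Q $ v $ j * x $ j = 0" if "j \<noteq> e" for j
  proof (cases "j \<in> B")
    case True
    then have "v \<noteq> et j" "v \<noteq> eh j" using uniq[of j] that ends_endpoints by blast+
    then show ?thesis by (simp add: Q_nth)
  qed (simp add: B_def)
  have "0 = (Q *v x) $ v" by (simp add: zero)
  also have "\<dots> = (\<Sum>j\<in>UNIV. Q $ v $ j * x $ j)" by (simp add: matrix_vector_mult_def)
  also have "\<dots> = (\<Sum>j\<in>{e}. Q $ v $ j * x $ j)"
    by (rule sum.mono_neutral_right) (use other in auto)
  finally have "Q $ v $ e * x $ e = 0" by simp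
  moreover have "Q $ v $ e \<noteq> 0"
    using e(2) loopfree[of e] w_pos[of e] by (auto simp: Q_nth joins_def)
  ultimately show False using e(1) by (simp add: B_def)
qed

definition tight :: "('v \<Rightarrow> real) \<Rightarrow> 'e set" where
  "tight f = {e. \<bar>f (et e) - f (eh e)\<bar> = w e}"

lemma tightE:
  assumes "e \<in> tight f"
  obtains u v where "ends e u v" "f u + w e = f v"
  using assms unfolding tight_def joins_def by (auto simp: abs_if split: if_splits)
      (metis add.commute diff_eq_eq eq_diff_eq minus_diff_eq)+

lemma tightI: "ends e u v \<Longrightarrow> f u + w e = f v \<Longrightarrow> e \<in> tight f"
  using w_pos[of e] unfolding tight_def joins_def by auto

end

text \<open>
  The only properties of the distance from a root that the analysis of the algorithm needs: it is
  Lipschitz for the edge weights, and every other vertex has exactly one edge along which the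
  distance to the root decreases by the full weight.
\<close>

locale rooted_distance = weighted_network et eh w Q
  for et eh :: "'e::finite \<Rightarrow> 'v::finite" and w :: "'e \<Rightarrow> real" and Q :: "real ^ 'e ^ 'v" +
  fixes r :: 'v and d :: "'v \<Rightarrow> real"
  assumes root: "d r = 0"
    and lip: "\<bar>d (et e) - d (eh e)\<bar> \<le> w e"
    and ex_parent: "v \<noteq> r \<Longrightarrow> \<exists>e u. joins et eh e u v \<and> d u + w e = d v"
    and parent_unique: "joins et eh e u v \<Longrightarrow> d u + w e = d v \<Longrightarrow>
      joins et eh e' u' v \<Longrightarrow> d u' + w e' = d v \<Longrightarrow> e = e'"
begin

lemma ends_lip: "ends e u v \<Longrightarrow> d v \<le> d u + w e"
  using lip[of e] unfolding joins_def by auto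

lemma root_induct [case_names root step]:
  assumes "P r"
    and step: "\<And>e u v. ends e u v \<Longrightarrow> d u + w e = d v \<Longrightarrow> P u \<Longrightarrow> P v"
  shows "P v"
proof (induction v rule: measure_induct_rule[where f = "\<lambda>v. card {u. d u < d v}"])
  case (less v)
  show ?case
  proof (cases "v = r")
    case False
    then obtain e u where e: "ends e u v" "d u + w e = d v" using ex_parent by blast
    then have "d u < d v" using w_pos[of e] by linarith
    then have "{x. d x < d u} \<subset> {x. d x < d v}" by force
    then have "P u" by (intro less psubset_card_mono) auto
    with e step show ?thesis by blast
  qed (use assms in simp)
qed

lemma d_nonneg: "0 \<le> d v"
proof (induction v rule: root_induct)
  case (step e u v)
  then show ?case using w_pos[of e] by linarith
qed (simp add: root)

text \<open>
  Telescoping along the unique shortest path from the root. This is the only way in which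
  Lipschitz functions are compared with distances; applied to the distance from another root it
  also yields the symmetry of distances and the triangle inequality.
\<close>

lemma lipschitz_bound:
  assumes "\<And>e. \<bar>f (et e) - f (eh e)\<bar> \<le> c * w e"
  shows "\<bar>f v - f r\<bar> \<le> c * d v"
proof (induction v rule: root_induct)
  case (step e u v)
  have "\<bar>f v - f u\<bar> \<le> c * w e" using assms[of e] step(1) by (auto simp: joins_def)
  moreover have "c * d v = c * d u + c * w e" using step(2) by (metis distrib_left)
  ultimately show ?case using step(3) by linarith
qed (simp add: root)

text \<open>
  The flow is the unit flow along the shortest path from the root to \<open>v\<close>, built edge by edge. The
  set \<open>P\<close> confines it: balls around the root and the set of vertices on a fixed shortest path
  are both closed under passing to the parent, and these are the two cases that are used.
\<close>

lemma path_flow: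
  assumes closed: "\<And>e u v. ends e u v \<Longrightarrow> d u + w e = d v \<Longrightarrow> v \<in> P \<Longrightarrow> u \<in> P"
    and "v \<in> P"
  shows "\<exists>F. Q *v F = axis r 1 - axis v 1 \<and>
    (\<forall>j. F $ j \<noteq> 0 \<longrightarrow> j \<in> tight d \<and> et j \<in> P \<and> eh j \<in> P) \<and>
    (\<forall>j. 0 \<le> F $ j * (d (eh j) - d (et j)))"
  using \<open>v \<in> P\<close>
proof (induction v rule: root_induct)
  case root
  show ?case by (intro exI[of _ 0]) simp
next
  case (step e u v)
  then have "u \<in> P" using closed by blast
  with step obtain F where F: "Q *v F = axis r 1 - axis u 1"
    "\<And>j. F $ j \<noteq> 0 \<Longrightarrow> j \<in> tight d \<and> et j \<in> P \<and> eh j \<in> P"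
    "\<And>j. 0 \<le> F $ j * (d (eh j) - d (et j))"
    by blast
  define c where "c = (if u = et e then w e else - w e)"
  have c: "u = et e \<and> v = eh e \<and> c = w e \<or> u = eh e \<and> v = et e \<and> c = - w e"
    using step(1) loopfree[of e] by (auto simp: joins_def c_def)
  let ?F = "F + axis e c"
  have "Q *v axis e c = axis u 1 - axis v 1"
    using c w_pos[of e] by (auto simp: Q_mult_axis)
  then have "Q *v ?F = axis r 1 - axis v 1"
    by (simp add: F(1) matrix_vector_right_distrib)
  moreover have "j \<in> tight d \<and> et j \<in> P \<and> eh j \<in> P" if "?F $ j \<noteq> 0" for j
  proof (cases "j = e")
    case True
    then show ?thesis using step \<open>u \<in> P\<close> c tightI by blast
  next
    case False
    then show ?thesis using F(2)[of j] that by (simp add: axis_def)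
  qed
  moreover have "0 \<le> ?F $ j * (d (eh j) - d (et j))" for j
  proof (cases "j = e")
    case True
    have "c * (d (eh e) - d (et e)) = w e * w e"
      using c step(2)[symmetric] by (auto simp: algebra_simps)
    then show ?thesis using F(3)[of e] True by (simp add: axis_def distrib_right)
  next
    case False
    then show ?thesis using F(3)[of j] by (simp add: axis_def)
  qed
  ultimately show ?case by blast
qed

definition dist_ball :: "real \<Rightarrow> 'v set" where
  "dist_ball a = {v. d v \<le> a}"

definition ball_edges :: "real \<Rightarrow> 'e set" where
  "ball_edges a = {e \<in> tight d. et e \<in> dist_ball a \<and> eh e \<in> dist_ball a}"

lemma ball_edgesE:
  assumes "e \<in> ball_edges a"
  obtains u v where "ends e u v" "d u + w e = d v" "d v \<le> a"
proof -
  have "e \<in> tight d" and dist_ball: "d (et e) \<le> a" "d (eh e) \<le> a"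
    using assms by (auto simp: ball_edges_def dist_ball_def)
  from this(1) obtain u v where "ends e u v" "d u + w e = d v" by (rule tightE)
  then show ?thesis using that dist_ball by (auto simp: joins_def)
qed

lemma ball_edgesI: "ends e u v \<Longrightarrow> d u + w e = d v \<Longrightarrow> d v \<le> a \<Longrightarrow> e \<in> ball_edges a"
  using w_pos[of e] tightI[of e u v d] unfolding ball_edges_def dist_ball_def
  by (auto simp: joins_def)

lemma ball_edges_mono: "a \<le> b \<Longrightarrow> ball_edges a \<subseteq> ball_edges b"
  by (auto simp: ball_edges_def dist_ball_def)

lemma ball_flow:
  assumes "d v \<le> a"
  shows "\<exists>F. Q *v F = axis r 1 - axis v 1 \<and> (\<forall>j. F $ j \<noteq> 0 \<longrightarrow> j \<in> ball_edges a) \<and>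
    (\<forall>j. 0 \<le> F $ j * (d (eh j) - d (et j)))"
proof -
  have "\<And>e u v. ends e u v \<Longrightarrow> d u + w e = d v \<Longrightarrow> v \<in> dist_ball a \<Longrightarrow> u \<in> dist_ball a"
    using w_pos by (auto simp: dist_ball_def) (smt (verit))
  from path_flow[where P = "dist_ball a" and v = v, OF this] assms show ?thesis
    unfolding ball_edges_def by (auto simp: dist_ball_def)
qed

text \<open>
  Superposition of the flows of the previous lemma: \<open>p v\<close> units are sent from the root to each
  vertex \<open>v\<close> of the ball. If nothing negative is sent, all flows run away from the root and
  cannot cancel, which is what keeps the signs of the coefficients fixed.
\<close>

lemma distributed_flow:
  assumes supp: "\<And>v. p v \<noteq> 0 \<Longrightarrow> d v \<le> a" and total: "(\<Sum>v\<in>UNIV. p v) = 1"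
  shows "\<exists>F. Q *v F = axis r 1 - (\<chi> v. p v) \<and> (\<forall>j. F $ j \<noteq> 0 \<longrightarrow> j \<in> ball_edges a) \<and>
    ((\<forall>v. 0 \<le> p v) \<longrightarrow> (\<forall>j. 0 \<le> F $ j * (d (eh j) - d (et j))))"
proof -
  have "\<forall>v. \<exists>F. d v \<le> a \<longrightarrow> Q *v F = axis r 1 - axis v 1 \<and> (\<forall>j. F $ j \<noteq> 0 \<longrightarrow> j \<in> ball_edges a) \<and>
    (\<forall>j. 0 \<le> F $ j * (d (eh j) - d (et j)))"
    using ball_flow by blast
  then obtain F where F: "\<And>v. d v \<le> a \<Longrightarrow> Q *v F v = axis r 1 - axis v 1"
    "\<And>v j. d v \<le> a \<Longrightarrow> F v $ j \<noteq> 0 \<Longrightarrow> j \<in> ball_edges a"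
    "\<And>v j. d v \<le> a \<Longrightarrow> 0 \<le> F v $ j * (d (eh j) - d (et j))"
    by metis
  let ?F = "\<Sum>v\<in>UNIV. p v *\<^sub>R F v"
  have "Q *v ?F = (\<Sum>v\<in>UNIV. p v *\<^sub>R (Q *v F v))"
    by (simp add: matrix_vector_mult_scaleR linear_sum[OF matrix_vector_mul_linear])
  also have "\<dots> = (\<Sum>v\<in>UNIV. p v *\<^sub>R (axis r 1 - axis v 1))"
    using F(1) supp by (intro sum.cong refl) (metis scaleR_zero_left)
  also have "\<dots> = (\<Sum>v\<in>UNIV. p v) *\<^sub>R axis r 1 - (\<Sum>v\<in>UNIV. p v *\<^sub>R axis v 1)"
    by (simp add: scaleR_right_diff_distrib sum_subtractf scaleR_sum_left)
  also have "(\<Sum>v\<in>UNIV. p v *\<^sub>R axis v 1) = (\<chi> v. p v)"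
    by (simp add: vec_eq_iff axis_def mult_delta_right)
  finally have "Q *v ?F = axis r 1 - (\<chi> v. p v)" by (simp add: total)
  moreover have "j \<in> ball_edges a" if "?F $ j \<noteq> 0" for j
  proof -
    have "(\<Sum>v\<in>UNIV. p v * F v $ j) \<noteq> 0" using that by simp
    then obtain v where "p v * F v $ j \<noteq> 0" by (meson sum.not_neutral_contains_not_neutral)
    then show ?thesis using F(2) supp by auto
  qed
  moreover have "0 \<le> ?F $ j * (d (eh j) - d (et j))" if "\<forall>v. 0 \<le> p v" for j
  proof -
    have "0 \<le> p v * F v $ j * (d (eh j) - d (et j))" for v
      using F(3)[of v j] supp[of v] that by (cases "p v = 0") (auto simp: mult.assoc)
    then show ?thesis by (simp add: sum_distrib_right sum_nonneg)
  qed
  ultimately show ?thesis by blast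
qed

end

section \<open>Two roots: the forest and its potential\<close>

lemma finite_max_element:
  fixes h :: "'a \<Rightarrow> real"
  assumes "finite B" "B \<noteq> {}"
  obtains e where "e \<in> B" "\<And>e'. e' \<in> B \<Longrightarrow> h e' \<le> h e"
proof -
  have "Max (h ` B) \<in> h ` B" using assms by simp
  then obtain e where "e \<in> B" "h e = Max (h ` B)" by auto
  then show ?thesis using that assms by simp
qed

locale two_rooted = weighted_network et eh w Q +
    S: rooted_distance et eh w Q s ds + T: rooted_distance et eh w Q t dt
  for et eh :: "'e::finite \<Rightarrow> 'v::finite" and w :: "'e \<Rightarrow> real" and Q :: "real ^ 'e ^ 'v"
    and s t :: 'v and ds dt :: "'v \<Rightarrow> real" +
  assumes neq: "s \<noteq> t"
begin

lemma distance_sym: "ds t = dt s"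
proof -
  have "\<bar>dt t - dt s\<bar> \<le> 1 * ds t" by (rule S.lipschitz_bound) (simp add: T.lip)
  moreover have "\<bar>ds s - ds t\<bar> \<le> 1 * dt s" by (rule T.lipschitz_bound) (simp add: S.lip)
  ultimately show ?thesis by (simp add: S.root T.root)
qed

lemma triangle: "ds t \<le> ds v + dt v"
proof -
  have "\<bar>ds v - ds t\<bar> \<le> 1 * dt v" by (rule T.lipschitz_bound) (simp add: S.lip)
  then show ?thesis by simp
qed

definition geodesic_edges :: "'e set" where
  "geodesic_edges = {e. \<exists>u v. ends e u v \<and> ds u + w e + dt v = ds t}"

text \<open>
  Equality in the triangle inequality: both endpoints lie on a shortest path from \<open>s\<close> to \<open>t\<close>, and
  the edge is tight for both distances.
\<close>

lemma geodesic_edge: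
  assumes "ends e u v" "ds u + w e + dt v = ds t"
  shows "ds u + w e = ds v" "dt v + w e = dt u" "ds v + dt v = ds t" "ds u + dt u = ds t"
  using S.ends_lip[OF assms(1)] T.ends_lip[OF ends_sym[THEN iffD1, OF assms(1)]]
    triangle[of u] triangle[of v] assms(2) by linarith+

text \<open>
  Among the edges of \<open>B\<close> in the \<open>s\<close>-ball that are not on the shortest path from \<open>s\<close> to \<open>t\<close>, one
  whose outer endpoint \<open>v\<close> is farthest from \<open>s\<close> is a leaf: the vertex \<open>v\<close> is off the path,
  hence outside the other ball, so another edge at \<open>v\<close> would lead farther away or be a
  second edge to the parent.
\<close>

lemma leaf_in_ball_edges:
  assumes A: "B \<subseteq> S.ball_edges a \<union> T.ball_edges b \<union> geodesic_edges" and ab: "a + b \<le> ds t"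
    and ne: "B \<inter> (S.ball_edges a - geodesic_edges) \<noteq> {}"
  shows "\<exists>e\<in>B. \<exists>u v. ends e u v \<and> (\<forall>e'\<in>B. \<forall>z. ends e' v z \<longrightarrow> e' = e)"
proof -
  define h where "h e = max (ds (et e)) (ds (eh e))" for e
  let ?B = "B \<inter> (S.ball_edges a - geodesic_edges)"
  obtain e where e: "e \<in> ?B" and max: "\<And>e'. e' \<in> ?B \<Longrightarrow> h e' \<le> h e"
    using finite_max_element[of ?B h] ne finite[of ?B] by blast
  obtain u v where uv: "ends e u v" "ds u + w e = ds v" "ds v \<le> a"
    using e by (auto elim: S.ball_edgesE)
  have he: "h e = ds v" using uv w_pos[of e] by (auto simp: h_def joins_def)
  have off: "ds v + dt v \<noteq> ds t"
  proof
    assume "ds v + dt v = ds t"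
    then have "ends e u v \<and> ds u + w e + dt v = ds t" using uv by simp
    then have "e \<in> geodesic_edges" unfolding geodesic_edges_def by blast
    then show False using e by simp
  qed
  have "e' = e" if e': "e' \<in> B" "ends e' v z" for e' z
  proof -
    have "e' \<notin> geodesic_edges"
    proof
      assume "e' \<in> geodesic_edges"
      then obtain x y where xy: "ends e' x y" "ds x + w e' + dt y = ds t"
        by (auto simp: geodesic_edges_def)
      then have "v = x \<or> v = y" using e' by (auto simp: joins_def)
      then show False using geodesic_edge[OF xy] off by auto
    qed
    \<comment> \<open>a vertex in both balls is on the shortest path, because \<open>a + b \<le> ds t\<close>\<close>
    moreover have "e' \<notin> T.ball_edges b"
    proof
      assume "e' \<in> T.ball_edges b"
      then have "dt v \<le> b" using e' by (auto simp: T.ball_edges_def T.dist_ball_def joins_def)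
      then show False using uv ab off triangle[of v] by linarith
    qed
    ultimately have eB: "e' \<in> ?B" using A e' by blast
    then obtain x y where xy: "ends e' x y" "ds x + w e' = ds y" "ds y \<le> a"
      by (auto elim: S.ball_edgesE)
    have "h e' = ds y" using xy w_pos[of e'] by (auto simp: h_def joins_def)
    then have "ds y \<le> ds v" using max[OF eB] he by simp
    moreover have "ds x < ds y" using xy(2) w_pos[of e'] by linarith
    moreover have "v = x \<or> v = y" using xy(1) e'(2) by (auto simp: joins_def)
    ultimately have "v = y" by auto
    then have "ds x + w e' = ds v" "ends e' x v" using xy by simp_all
    then show "e' = e" using S.parent_unique uv(1,2) by metis
  qed
  then show ?thesis using e uv by blast
qed

end

lemma two_rooted_swap:
  "two_rooted et eh w Q s t ds dt \<Longrightarrow> two_rooted et eh w Q t s dt ds"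
  unfolding two_rooted_def two_rooted_axioms_def by blast

context two_rooted
begin

text \<open>
  If all edges of a set lie on the shortest path from \<open>s\<close> to \<open>t\<close>, the one farthest from \<open>s\<close> is a
  leaf. Otherwise the previous lemma applies to one of the two roots. The case
  \<open>a + b = ds t\<close>, in which the balls touch, is included: it is needed after the last step.
\<close>

lemma columns_independent:
  assumes A: "A \<subseteq> S.ball_edges a \<union> T.ball_edges b \<union> geodesic_edges" and ab: "a + b \<le> ds t"
    and supp: "\<And>j. j \<notin> A \<Longrightarrow> x $ j = 0" and zero: "Q *v x = 0"
  shows "x = 0"
  using _ supp zero
proof (rule forest_columns_independent)
  fix B assume "B \<subseteq> A" "B \<noteq> {}"
  then have B: "B \<subseteq> S.ball_edges a \<union> T.ball_edges b \<union> geodesic_edges" using A by blast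
  interpret swap: two_rooted et eh w Q t s dt ds
    by (rule two_rooted_swap) (rule two_rooted_axioms)
  have geo: "swap.geodesic_edges = geodesic_edges"
  proof (intro set_eqI iffI)
    fix e assume "e \<in> swap.geodesic_edges"
    then obtain u v where "ends e u v" "dt u + w e + ds v = dt s"
      unfolding swap.geodesic_edges_def by blast
    then have "ends e v u \<and> ds v + w e + dt u = ds t" using ends_sym distance_sym by simp
    then show "e \<in> geodesic_edges" unfolding geodesic_edges_def by blast
  next
    fix e assume "e \<in> geodesic_edges"
    then obtain u v where "ends e u v" "ds u + w e + dt v = ds t"
      unfolding geodesic_edges_def by blast
    then have "ends e v u \<and> dt v + w e + ds u = dt s" using ends_sym distance_sym by simp
    then show "e \<in> swap.geodesic_edges" unfolding swap.geodesic_edges_def by blast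
  qed
  consider "B \<inter> (S.ball_edges a - geodesic_edges) \<noteq> {}" | "B \<inter> (T.ball_edges b - geodesic_edges) \<noteq> {}"
    | "B \<subseteq> geodesic_edges" using B by blast
  then show "\<exists>e\<in>B. \<exists>u v. ends e u v \<and> (\<forall>e'\<in>B. \<forall>z. ends e' v z \<longrightarrow> e' = e)"
  proof cases
    case 1
    show ?thesis by (rule leaf_in_ball_edges[OF B ab 1])
  next
    case 2
    show ?thesis
    proof (rule swap.leaf_in_ball_edges)
      show "B \<subseteq> T.ball_edges b \<union> S.ball_edges a \<union> swap.geodesic_edges" using B geo by blast
      show "b + a \<le> dt s" using ab distance_sym by simp
      show "B \<inter> (T.ball_edges b - swap.geodesic_edges) \<noteq> {}" using 2 geo by simp
    qed
  next
    case 3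
    define h where "h e = max (ds (et e)) (ds (eh e))" for e
    obtain e where e: "e \<in> B" and max: "\<And>e'. e' \<in> B \<Longrightarrow> h e' \<le> h e"
      using finite_max_element[of B h] \<open>B \<noteq> {}\<close> finite[of B] by blast
    obtain u v where uv: "ends e u v" "ds u + w e + dt v = ds t"
      using e 3 by (auto simp: geodesic_edges_def)
    have he: "h e = ds v" using geodesic_edge[OF uv] uv w_pos[of e] by (auto simp: h_def joins_def)
    have "e' = e" if e': "e' \<in> B" "ends e' v z" for e' z
    proof -
      obtain x y where xy: "ends e' x y" "ds x + w e' + dt y = ds t"
        using e' 3 by (auto simp: geodesic_edges_def)
      have "h e' = ds y" using geodesic_edge[OF xy] xy w_pos[of e'] by (auto simp: h_def joins_def)
      then have "ds y \<le> ds v" using max[OF e'(1)] he by simp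
      moreover have "ds x < ds y" using geodesic_edge(1)[OF xy] w_pos[of e'] by linarith
      moreover have "v = x \<or> v = y" using xy(1) e'(2) by (auto simp: joins_def)
      ultimately have "v = y" by auto
      then have "ds x + w e' = ds v" "ends e' x v" using geodesic_edge(1)[OF xy] xy(1) by simp_all
      then show "e' = e" using S.parent_unique geodesic_edge(1)[OF uv] uv(1) by metis
    qed
    then show ?thesis using e uv by blast
  qed
qed

text \<open>
  The residual of the solution path at \<open>\<lambda>\<close>, divided by \<open>\<lambda>\<close>, when the balls around \<open>s\<close> and \<open>t\<close> have
  radii \<open>a\<close> and \<open>b\<close>.
\<close>

definition potential :: "real \<Rightarrow> real \<Rightarrow> 'v \<Rightarrow> real" where
  "potential a b v = max 0 (a - ds v) - max 0 (b - dt v)"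

lemma potential_S: "a + b \<le> ds t \<Longrightarrow> ds v \<le> a \<Longrightarrow> potential a b v = a - ds v"
  using triangle[of v] unfolding potential_def by linarith

lemma potential_T: "a + b \<le> ds t \<Longrightarrow> dt v \<le> b \<Longrightarrow> potential a b v = dt v - b"
  using triangle[of v] unfolding potential_def by linarith

lemma potential_geodesic:
  "a + b = ds t \<Longrightarrow> ds v + dt v = ds t \<Longrightarrow> potential a b v = a - ds v"
  unfolding potential_def by linarith

lemma potential_drop:
  assumes "ends e u v" "a + b \<le> ds t"
  shows "potential a b u - potential a b v \<le> w e"
  using S.ends_lip[OF assms(1)] T.ends_lip[OF ends_sym[THEN iffD1, OF assms(1)]]
    triangle[of v] assms(2) w_pos[of e]
  unfolding potential_def by linarith

lemma potential_lip: "a + b \<le> ds t \<Longrightarrow> \<bar>potential a b (et e) - potential a b (eh e)\<bar> \<le> w e"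
  using potential_drop[of e "et e" "eh e" a b] potential_drop[of e "eh e" "et e" a b] ends_endpoints[of e]
  by auto

text \<open>
  A tight edge descends by its full weight. If it stays in the part where the potential is
  nonnegative (nonpositive), it is tight for the distance from \<open>s\<close> (from \<open>t\<close>). If it changes
  sign, its weight together with the distances of its endpoints from \<open>s\<close> and \<open>t\<close> is \<open>a + b\<close>,
  which is possible only if the two balls meet on the shortest path.
\<close>

lemma tight_potential_subset:
  assumes ab: "a + b \<le> ds t"
  shows "tight (potential a b) \<subseteq> S.ball_edges a \<union> T.ball_edges b \<union>
    (if a + b = ds t then geodesic_edges else {})"
proof
  fix e assume "e \<in> tight (potential a b)"
  then obtain v u where uv: "ends e v u" "potential a b v + w e = potential a b u" by (rule tightE)
  have "ds u + w e = ds v \<and> ds v \<le> a \<or> dt v + w e = dt u \<and> dt u \<le> b \<or>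
      ds u + w e + dt v = ds t \<and> a + b = ds t"
    using uv(2) S.ends_lip[OF ends_sym[THEN iffD1, OF uv(1)]] T.ends_lip[OF uv(1)]
      triangle[of v] ab w_pos[of e]
    unfolding potential_def by (smt (verit))
  then show "e \<in> S.ball_edges a \<union> T.ball_edges b \<union> (if a + b = ds t then geodesic_edges else {})"
    using S.ball_edgesI[of e u v a] T.ball_edgesI[of e v u b] uv(1) ends_sym[of e u v]
    unfolding geodesic_edges_def by auto
qed

lemma ball_edges_S:
  assumes ab: "a + b \<le> ds t" and "j \<in> S.ball_edges a"
  shows "j \<in> tight (potential a b)"
    "potential a b (et j) - potential a b (eh j) = ds (eh j) - ds (et j)"
proof -
  have b: "ds (et j) \<le> a" "ds (eh j) \<le> a" and t: "j \<in> tight ds"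
    using assms by (auto simp: S.ball_edges_def S.dist_ball_def)
  then show eq: "potential a b (et j) - potential a b (eh j) = ds (eh j) - ds (et j)"
    by (simp add: potential_S ab)
  show "j \<in> tight (potential a b)" using t unfolding tight_def mem_Collect_eq eq
    by (simp add: abs_minus_commute)
qed

lemma ball_edges_T:
  assumes ab: "a + b \<le> ds t" and "j \<in> T.ball_edges b"
  shows "j \<in> tight (potential a b)"
    "potential a b (et j) - potential a b (eh j) = dt (et j) - dt (eh j)"
proof -
  have b: "dt (et j) \<le> b" "dt (eh j) \<le> b" and t: "j \<in> tight dt"
    using assms by (auto simp: T.ball_edges_def T.dist_ball_def)
  then show eq: "potential a b (et j) - potential a b (eh j) = dt (et j) - dt (eh j)"
    by (simp add: potential_T ab)
  show "j \<in> tight (potential a b)" using t unfolding tight_def mem_Collect_eq eq by simp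
qed

lemma tight_potential:
  "a + b < ds t \<Longrightarrow> tight (potential a b) = S.ball_edges a \<union> T.ball_edges b"
  using tight_potential_subset[of a b] ball_edges_S(1)[of a b] ball_edges_T(1)[of a b] by auto

lemma tight_potential_independent:
  assumes "a + b \<le> ds t" "\<And>j. j \<notin> tight (potential a b) \<Longrightarrow> x $ j = 0" "Q *v x = 0"
  shows "x = 0"
  using columns_independent[of "tight (potential a b)" a b x] tight_potential_subset[of a b] assms
  by (auto split: if_splits)

text \<open>
  On the shortest path from \<open>s\<close> to \<open>t\<close> the potential falls from \<open>a\<close> to \<open>-b\<close>, in total by the
  length of the path when \<open>a + b = ds t\<close>. So it has to fall by the full weight on each edge.
\<close>

lemma geodesic_tight:
  assumes ab: "a + b = ds t" and "ends e u v" "ds u + w e = ds v" "ds v + dt v = ds t"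
  shows "e \<in> tight (potential a b)" "ds u + dt u = ds t"
proof -
  have "ds u + w e + dt v = ds t" using assms(3,4) by linarith
  then show u: "ds u + dt u = ds t" by (rule geodesic_edge(4)[OF assms(2)])
  have "potential a b v + w e = potential a b u"
    using assms(3)
    unfolding potential_geodesic[OF ab u] potential_geodesic[OF ab assms(4)] by linarith
  then show "e \<in> tight (potential a b)" using assms(2) ends_sym tightI by blast
qed

definition demand :: "real ^ 'v" where
  "demand = axis s 1 - axis t 1"

text \<open>
  When the balls meet, the demand is met exactly, by the unit flow along the shortest path from
  \<open>s\<close> to \<open>t\<close>: this is the least squares solution on the last active set.
\<close>

lemma geodesic_flow:
  assumes ab: "a + b = ds t"
  shows "\<exists>x. Q *v x = demand \<and> (\<forall>j. x $ j \<noteq> 0 \<longrightarrow> j \<in> tight (potential a b)) \<and>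
    (\<forall>j. 0 \<le> x $ j * (potential a b (et j) - potential a b (eh j)))"
proof -
  let ?P = "{v. ds v + dt v = ds t}"
  have "\<exists>x. Q *v x = axis s 1 - axis t 1 \<and>
      (\<forall>j. x $ j \<noteq> 0 \<longrightarrow> j \<in> tight ds \<and> et j \<in> ?P \<and> eh j \<in> ?P) \<and>
      (\<forall>j. 0 \<le> x $ j * (ds (eh j) - ds (et j)))"
  proof (rule S.path_flow)
    show "u \<in> ?P" if "ends e u v" "ds u + w e = ds v" "v \<in> ?P" for e u v
      using geodesic_tight(2)[OF ab that(1,2)] that(3) by blast
    show "t \<in> ?P" by (simp add: T.root)
  qed
  then obtain x where x: "Q *v x = demand" and
    supp: "\<And>j. x $ j \<noteq> 0 \<Longrightarrow> j \<in> tight ds \<and> et j \<in> ?P \<and> eh j \<in> ?P" and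
    sign: "\<And>j. 0 \<le> x $ j * (ds (eh j) - ds (et j))"
    unfolding demand_def by blast
  have pot: "potential a b (et j) - potential a b (eh j) = ds (eh j) - ds (et j)" if "x $ j \<noteq> 0"
    for j
  proof -
    have on: "ds (et j) + dt (et j) = ds t" "ds (eh j) + dt (eh j) = ds t"
      using supp[OF that] by auto
    show ?thesis unfolding on[THEN potential_geodesic[OF ab]] by linarith
  qed
  have "j \<in> tight (potential a b)" if "x $ j \<noteq> 0" for j
  proof -
    have "\<bar>ds (eh j) - ds (et j)\<bar> = w j"
      using supp[OF that] unfolding tight_def by (simp add: abs_minus_commute)
    then show ?thesis unfolding tight_def mem_Collect_eq pot[OF that] .
  qed
  moreover have "0 \<le> x $ j * (potential a b (et j) - potential a b (eh j))" for j
  proof (cases "x $ j = 0")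
    case False
    show ?thesis unfolding pot[OF False] by (rule sign)
  qed simp
  ultimately show ?thesis using x by blast
qed

text \<open>
  The coefficient vectors of the solution path: the flow distributes the unit that enters at \<open>s\<close>
  over the \<open>s\<close>-ball according to \<open>p\<close> and collects the unit that leaves at \<open>t\<close> from the \<open>t\<close>-ball
  according to \<open>q\<close>; the residual is then \<open>p - q\<close>. For nonnegative \<open>p\<close> and \<open>q\<close> everything flows
  downhill with respect to the potential.
\<close>

lemma two_sided_flow:
  assumes ab: "a + b \<le> ds t"
    and p: "\<And>v. p v \<noteq> 0 \<Longrightarrow> ds v \<le> a" "(\<Sum>v\<in>UNIV. p v) = 1"
    and q: "\<And>v. q v \<noteq> 0 \<Longrightarrow> dt v \<le> b" "(\<Sum>v\<in>UNIV. q v) = 1"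
  shows "\<exists>x. Q *v x = demand - (\<chi> v. p v - q v) \<and> (\<forall>j. x $ j \<noteq> 0 \<longrightarrow> j \<in> tight (potential a b)) \<and>
    ((\<forall>v. 0 \<le> p v \<and> 0 \<le> q v) \<longrightarrow> (\<forall>j. 0 \<le> x $ j * (potential a b (et j) - potential a b (eh j))))"
proof -
  obtain F where F: "Q *v F = axis s 1 - (\<chi> v. p v)" "\<And>j. F $ j \<noteq> 0 \<Longrightarrow> j \<in> S.ball_edges a"
    "(\<forall>v. 0 \<le> p v) \<Longrightarrow> 0 \<le> F $ j * (ds (eh j) - ds (et j))" for j
    using S.distributed_flow[of p a] p by auto
  obtain H where H: "Q *v H = axis t 1 - (\<chi> v. q v)" "\<And>j. H $ j \<noteq> 0 \<Longrightarrow> j \<in> T.ball_edges b"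
    "(\<forall>v. 0 \<le> q v) \<Longrightarrow> 0 \<le> H $ j * (dt (eh j) - dt (et j))" for j
    using T.distributed_flow[of q b] q by auto
  let ?\<Delta> = "\<lambda>j. potential a b (et j) - potential a b (eh j)"
  \<comment> \<open>\<open>H\<close> runs away from \<open>t\<close>, which is uphill for the potential, so it enters negatively\<close>
  have "Q *v (F - H) = demand - (\<chi> v. p v - q v)"
    by (simp add: matrix_vector_mult_diff_distrib F(1) H(1) demand_def vec_eq_iff)
  moreover have "j \<in> tight (potential a b)" if "(F - H) $ j \<noteq> 0" for j
    using that F(2)[of j] H(2)[of j] ball_edges_S(1)[OF ab, of j] ball_edges_T(1)[OF ab, of j]
    by (cases "F $ j = 0") auto
  moreover have "0 \<le> (F - H) $ j * ?\<Delta> j" if pq: "\<forall>v. 0 \<le> p v \<and> 0 \<le> q v" for j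
  proof -
    have "0 \<le> F $ j * ?\<Delta> j"
    proof (cases "F $ j = 0")
      case False
      show ?thesis unfolding ball_edges_S(2)[OF ab F(2)[OF False]] using F(3)[of j] pq by blast
    qed simp
    moreover have "0 \<le> - H $ j * ?\<Delta> j"
    proof (cases "H $ j = 0")
      case False
      have "0 \<le> H $ j * (dt (eh j) - dt (et j))" using H(3)[of j] pq by blast
      then show ?thesis unfolding ball_edges_T(2)[OF ab H(2)[OF False]] by (simp add: algebra_simps)
    qed simp
    ultimately show ?thesis by (simp add: algebra_simps)
  qed
  ultimately show ?thesis by blast
qed

end

section \<open>Breakpoints of the solution path\<close>

context rooted_distance
begin

lemma root_in_ball: "0 \<le> a \<Longrightarrow> r \<in> dist_ball a"
  by (simp add: dist_ball_def root)

text \<open>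
  On a segment of the solution path the ball stays fixed and the residual at \<open>l\<close> decreases with
  slope \<open>l\<close> in the distance from the root. The level is its value at the root, determined by the
  condition that the residual sums to \<open>1\<close> over the ball.
\<close>

definition level :: "real \<Rightarrow> real \<Rightarrow> real" where
  "level a l = (1 + l * (\<Sum>v\<in>dist_ball a. d v)) / card (dist_ball a)"

lemma card_ball: "0 \<le> a \<Longrightarrow> 0 < card (dist_ball a)"
  using root_in_ball[of a] by (auto simp: card_gt_0_iff)

lemma level_total:
  assumes "0 \<le> a"
  shows "(\<Sum>v\<in>UNIV. if v \<in> dist_ball a then level a l - l * d v else 0) = 1"
proof -
  have "(\<Sum>v\<in>UNIV. if v \<in> dist_ball a then level a l - l * d v else 0)
    = (\<Sum>v\<in>dist_ball a. level a l - l * d v)"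
    by (simp add: sum.If_cases)
  also have "\<dots> = 1"
    using root_in_ball[OF assms] by (auto simp: sum_subtractf level_def sum_distrib_left[symmetric])
  finally show ?thesis .
qed

lemma level_eq:
  assumes "0 < a" and "L * (\<Sum>v\<in>UNIV. max 0 (a - d v)) = 1"
  shows "level a L = L * a"
proof -
  have "(\<Sum>v\<in>UNIV. max 0 (a - d v)) = (\<Sum>v\<in>UNIV. if v \<in> dist_ball a then a - d v else 0)"
    by (rule sum.cong) (auto simp: dist_ball_def)
  also have "\<dots> = (\<Sum>v\<in>dist_ball a. a - d v)" by (simp add: sum.If_cases)
  also have "\<dots> = card (dist_ball a) * a - (\<Sum>v\<in>dist_ball a. d v)" by (simp add: sum_subtractf)
  finally have "L * (card (dist_ball a) * a) = 1 + L * (\<Sum>v\<in>dist_ball a. d v)"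
    using assms(2) by (simp add: right_diff_distrib)
  then show ?thesis
    using root_in_ball[of a] assms(1) unfolding level_def by (auto simp: divide_eq_eq mult_ac)
qed

text \<open>
  The radius is the level divided by the penalty. It grows when the penalty decreases, since the
  constant part of the level does not shrink with the penalty.
\<close>

lemma level_growth:
  assumes "0 < a" "0 < l" "l < L" and eq: "level a L = L * a"
  shows "l * a < level a l"
proof -
  define n where "n = real (card (dist_ball a))"
  define \<sigma> where "\<sigma> = (\<Sum>v\<in>dist_ball a. d v)"
  have n: "0 < n" using card_ball[of a] assms by (simp add: n_def)
  have "1 + L * \<sigma> = L * a * n"
    using eq n by (simp add: level_def n_def[symmetric] \<sigma>_def[symmetric] divide_eq_eq)
  then have "l * (L * a * n) = l * (1 + L * \<sigma>)" by simp
  also have "\<dots> < L * (1 + l * \<sigma>)" using assms by (simp add: algebra_simps)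
  finally have "L * (l * a * n) < L * (1 + l * \<sigma>)" by (simp add: algebra_simps)
  then have "l * a * n < 1 + l * \<sigma>" using assms by simp
  then show ?thesis using n
    by (simp add: level_def n_def[symmetric] \<sigma>_def[symmetric] less_divide_eq)
qed

text \<open>
  The new radius may be that of a larger ball; the vertices that enter lie on its boundary and
  contribute nothing, so the normalization of the old ball carries over.
\<close>

lemma level_normalized:
  assumes "0 \<le> a" "a \<le> a'" "level a l = l * a'" and out: "\<And>v. v \<notin> dist_ball a \<Longrightarrow> a' \<le> d v"
  shows "l * (\<Sum>v\<in>UNIV. max 0 (a' - d v)) = 1"
proof -
  have "l * (\<Sum>v\<in>UNIV. max 0 (a' - d v))
    = (\<Sum>v\<in>UNIV. if v \<in> dist_ball a then level a l - l * d v else 0)"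
    unfolding sum_distrib_left
  proof (rule sum.cong[OF refl])
    fix v
    show "l * max 0 (a' - d v) = (if v \<in> dist_ball a then level a l - l * d v else 0)"
      using out[of v] assms(2,3) by (auto simp: dist_ball_def max_def right_diff_distrib)
  qed
  then show ?thesis using level_total[OF assms(1)] by simp
qed

lemma d_ge_min_weight:
  assumes "\<And>e. m \<le> w e" "v \<noteq> r"
  shows "m \<le> d v"
proof -
  obtain e u where "d u + w e = d v" using ex_parent[OF assms(2)] by blast
  then show ?thesis using d_nonneg[of u] assms(1)[of e] by linarith
qed

end

context two_rooted
begin

abbreviation difference :: "real \<Rightarrow> real \<Rightarrow> 'e \<Rightarrow> real" where
  "difference a b j \<equiv> potential a b (et j) - potential a b (eh j)"

text \<open>
  The shape of the states, with parameters that determine it: \<open>L\<close> is the value of \<open>\<lambda>\<close> and \<open>a\<close>, \<open>b\<close>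
  are the radii of the balls. The two sums express that the residual \<open>L * potential a b\<close> carries
  the mass \<open>1\<close> around \<open>s\<close> and \<open>-1\<close> around \<open>t\<close>. In the initial state \<open>\<lambda>\<close> is infinite, and \<open>L\<close> is a
  finite stand-in above all joining times.
\<close>

definition breakpoint :: "'e lars_state \<Rightarrow> real \<Rightarrow> real \<Rightarrow> real \<Rightarrow> bool" where
  "breakpoint S L a b \<longleftrightarrow> 0 < L \<and> a + b \<le> ds t \<and>
     L * (\<Sum>v\<in>UNIV. max 0 (a - ds v)) = 1 \<and> L * (\<Sum>v\<in>UNIV. max 0 (b - dt v)) = 1 \<and>
     active S = tight (potential a b) \<and>
     signs S = (\<chi> j. if j \<in> active S then difference a b j / w j else 0) \<and>
     (lam S = ereal L \<or> lam S = \<infinity> \<and> active S = {})"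

lemma breakpoint_pos:
  assumes "breakpoint S L a b"
  shows "0 < a" "0 < b"
proof -
  have "\<not> a \<le> 0"
  proof
    assume "a \<le> 0"
    then have "max 0 (a - ds v) = 0" for v using S.d_nonneg[of v] by simp
    then show False using assms by (simp add: breakpoint_def)
  qed
  then show "0 < a" by simp
  have "\<not> b \<le> 0"
  proof
    assume "b \<le> 0"
    then have "max 0 (b - dt v) = 0" for v using T.d_nonneg[of v] by simp
    then show False using assms by (simp add: breakpoint_def)
  qed
  then show "0 < b" by simp
qed

lemma segment_at:
  assumes bp: "breakpoint S L a b"
    and supp: "\<And>j. x $ j \<noteq> 0 \<Longrightarrow> j \<in> tight (potential a b)"
    and Qx: "Q *v x = demand - (\<chi> v. R v)"
    and R: "\<And>j. j \<in> tight (potential a b) \<Longrightarrow> R (et j) - R (eh j) = l * difference a b j"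
  shows "lars_a Q demand (active S) - l *\<^sub>R lars_b Q (active S) (signs S) = x"
proof (rule lars_segment)
  have act: "active S = tight (potential a b)" and ab: "a + b \<le> ds t"
    and sg: "signs S = (\<chi> j. if j \<in> active S then difference a b j / w j else 0)"
    using bp by (auto simp: breakpoint_def)
  show "z = 0" if "\<And>j. j \<notin> active S \<Longrightarrow> z $ j = 0" "Q *v z = 0" for z
    using tight_potential_independent[OF ab] that act by simp
  show "x $ j = 0" if "j \<notin> active S" for j using supp that act by auto
  show "signs S $ j = 0" if "j \<notin> active S" for j using that by (simp add: sg)
  show "column j Q \<bullet> (demand - Q *v x) = l * signs S $ j" if "j \<in> active S" for j
    using R[of j] that act by (simp add: sg Qx column_inner)
qed

text \<open>
  At the breakpoint itself the masses \<open>p\<close> and \<open>q\<close> are \<open>L\<close> times the two halves of the potential,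
  which are nonnegative. This also applies when the balls touch, which gives the signs at
  the start of the last segment.
\<close>

lemma flow_at_breakpoint:
  assumes bp: "breakpoint S L a b"
  defines "x \<equiv> lars_a Q demand (active S) - L *\<^sub>R lars_b Q (active S) (signs S)"
  shows "Q *v x = demand - (\<chi> v. L * potential a b v)"
    and "j \<notin> active S \<Longrightarrow> x $ j = 0"
    and "0 \<le> x $ j * difference a b j"
proof -
  let ?p = "\<lambda>v. L * max 0 (a - ds v)" and ?q = "\<lambda>v. L * max 0 (b - dt v)"
  have L: "0 < L" and ab: "a + b \<le> ds t"
    and p: "(\<Sum>v\<in>UNIV. ?p v) = 1" and q: "(\<Sum>v\<in>UNIV. ?q v) = 1"
    and act: "active S = tight (potential a b)"
    using bp by (auto simp: breakpoint_def sum_distrib_left)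
  have ps: "ds v \<le> a" if "?p v \<noteq> 0" for v using that by (rule contrapos_np) simp
  have qs: "dt v \<le> b" if "?q v \<noteq> 0" for v using that by (rule contrapos_np) simp
  have nonneg: "\<forall>v. 0 \<le> ?p v \<and> 0 \<le> ?q v" using L by simp
  obtain z where
    z: "Q *v z = demand - (\<chi> v. ?p v - ?q v)" "\<And>j. z $ j \<noteq> 0 \<Longrightarrow> j \<in> tight (potential a b)"
    "\<And>j. 0 \<le> z $ j * difference a b j" using two_sided_flow[OF ab ps p qs q] nonneg by blast
  have pq: "?p v - ?q v = L * potential a b v" for v by (simp add: potential_def right_diff_distrib)
  have "x = z" unfolding x_def
    by (rule segment_at[OF bp z(2) z(1)]) (simp_all add: pq right_diff_distrib)
  then show "Q *v x = demand - (\<chi> v. L * potential a b v)" "j \<notin> active S \<Longrightarrow> x $ j = 0"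
    "0 \<le> x $ j * difference a b j"
    using z act unfolding pq by auto
qed

lemma inactive_slack:
  assumes "0 < L" "a + b \<le> ds t" "j \<notin> tight (potential a b)"
  shows "\<bar>L * difference a b j / w j\<bar> < L"
proof -
  have "\<bar>difference a b j\<bar> < w j" using assms(3) potential_lip[OF assms(2), of j]
    by (auto simp: tight_def)
  then have "L * \<bar>difference a b j\<bar> < L * w j" using assms(1) by simp
  then show ?thesis using assms(1) w_pos[of j] by (simp add: abs_mult divide_less_eq)
qed

text \<open>
  On the last active set the least squares residual vanishes, so every joining quotient has
  numerator \<open>0\<close>. The coefficients agree in sign with the potential at \<open>\<lambda> = 0\<close>, where they form the
  unit flow along the shortest path, and at \<open>\<lambda> = L\<close>, so there is no crossing either.
\<close>

lemma lars_step_connected: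
  assumes bp: "breakpoint S L a b" and lam: "lam S = ereal L" and ab: "a + b = ds t"
  shows "lam (lars_step Q demand S) = 0"
proof -
  have L: "0 < L" and act: "active S = tight (potential a b)" using bp
    by (auto simp: breakpoint_def)
  let ?a = "lars_a Q demand (active S)" and ?b = "lars_b Q (active S) (signs S)"
  obtain x where x: "Q *v x = demand" "\<And>j. x $ j \<noteq> 0 \<Longrightarrow> j \<in> tight (potential a b)"
    "\<And>j. 0 \<le> x $ j * difference a b j"
    using geodesic_flow[OF ab] by blast
  have "?a - 0 *\<^sub>R ?b = x"
    by (rule segment_at[OF bp x(2), where R = "\<lambda>_. 0"]) (simp_all add: x(1) vec_eq_iff)
  then have a: "?a = x" by simp
  have cross: "cross_time Q demand (active S) (signs S) (lam S) j = 0" if "j \<in> active S" for j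
    unfolding lam
  proof (rule cross_time_eq_0)
    show "0 \<le> ?a $ j * difference a b j" using x(3) a by simp
    show "0 \<le> (?a - L *\<^sub>R ?b) $ j * difference a b j" by (rule flow_at_breakpoint(3)[OF bp])
    show "difference a b j \<noteq> 0" using that act w_pos[of j] by (auto simp: tight_def)
  qed
  have corr: "column j Q \<bullet> (demand - active_columns Q (active S) *v (?a - l *\<^sub>R ?b)) =
      column j Q \<bullet> (demand - Q *v (?a - l *\<^sub>R ?b))" if "l = 0 \<or> l = L" for j l
  proof -
    have "(?a - l *\<^sub>R ?b) $ i = 0" if "i \<notin> active S" for i
    proof (cases "l = 0")
      case True
      have "x $ i = 0" using x(2)[of i] that act by blast
      then show ?thesis using True a by simp
    next
      case False
      then show ?thesis using \<open>l = 0 \<or> l = L\<close> flow_at_breakpoint(2)[OF bp that] by simp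
    qed
    then have "active_columns Q (active S) *v (?a - l *\<^sub>R ?b) = Q *v (?a - l *\<^sub>R ?b)"
      by (rule active_columns_mult)
    then show ?thesis by (rule arg_cong)
  qed
  have join: "join_time Q demand (active S) (signs S) (lam S) j = 0" if j: "j \<notin> active S" for j
  proof (rule join_time_properties(5)[OF L])
    show "ereal L \<le> lam S" by (simp add: lam)
    show "column j Q \<bullet> (demand - active_columns Q (active S) *v (?a - 0 *\<^sub>R ?b)) = 0"
      by (subst corr) (simp_all add: a x(1))
    show "\<bar>column j Q \<bullet> (demand - active_columns Q (active S) *v (?a - l *\<^sub>R ?b))\<bar> < l"
      if "L \<le> l" "ereal l \<le> lam S" for l
    proof -
      have l: "l = L" using that lam by simp
      show ?thesis unfolding l
        using inactive_slack[OF L _ j[unfolded act]] ab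
        by (subst corr) (simp_all add: flow_at_breakpoint(1)[OF bp] column_inner right_diff_distrib)
    qed
  qed
  have "join_time Q demand (active S) (signs S) (lam S) ` (- active S) \<subseteq> {0}" using join by auto
  then have "Max (insert 0 (join_time Q demand (active S) (signs S) (lam S) ` (- active S))) = 0"
    by (metis Max_singleton insert_absorb2 subset_singletonD)
  then show ?thesis using lars_step_join(1)[of S Q demand] cross lam L by simp
qed

text \<open>
  Along the segment the balls are fixed and the residual is \<open>R l\<close>, the difference of the masses
  \<open>p l\<close> and \<open>q l\<close> of the two balls, each affine in the distance from its root. The next breakpoint
  \<open>l\<close> is the largest value at which some inactive edge becomes tight for \<open>R l / l\<close>. There
  \<open>R l / l\<close> is Lipschitz on all edges, and comparing its values at \<open>s\<close> and \<open>t\<close> with those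
  elsewhere shows that it is the potential of the enlarged balls.
\<close>

lemma lars_step_disconnected:
  assumes bp: "breakpoint S L a b" and ab: "a + b < ds t"
  shows "\<exists>L' a' b'. breakpoint (lars_step Q demand S) L' a' b' \<and>
    lam (lars_step Q demand S) = ereal L' \<and> a \<le> a' \<and> b \<le> b' \<and>
    active S \<subset> active (lars_step Q demand S)"
proof -
  define A where "A = active S"
  define sg where "sg = signs S"
  have L: "0 < L" and act: "A = tight (potential a b)"
    and sg: "sg = (\<chi> j. if j \<in> A then difference a b j / w j else 0)"
    and lam: "lam S = ereal L \<or> lam S = \<infinity> \<and> A = {}"
    and norm: "L * (\<Sum>v\<in>UNIV. max 0 (a - ds v)) = 1" "L * (\<Sum>v\<in>UNIV. max 0 (b - dt v)) = 1"
    using bp by (auto simp: breakpoint_def A_def sg_def)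
  have ab': "a + b \<le> ds t" using ab by simp
  note pos = breakpoint_pos[OF bp]
  have disj: "v \<notin> S.dist_ball a \<or> v \<notin> T.dist_ball b" for v
    using triangle[of v] ab by (auto simp: S.dist_ball_def T.dist_ball_def)
  define p where "p l v = (if v \<in> S.dist_ball a then S.level a l - l * ds v else 0)" for l v
  define q where "q l v = (if v \<in> T.dist_ball b then T.level b l - l * dt v else 0)" for l v
  define R where "R l v = p l v - q l v" for l v
  define \<beta> where "\<beta> l = lars_a Q demand A - l *\<^sub>R lars_b Q A sg" for l
  have R_difference: "R l (et j) - R l (eh j) = l * difference a b j" if j: "j \<in> A" for l j
  proof -
    consider "j \<in> S.ball_edges a" | "j \<in> T.ball_edges b"
      using j unfolding act tight_potential[OF ab] by blast
    then show ?thesis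
    proof cases
      case 1
      then have "et j \<in> S.dist_ball a" "eh j \<in> S.dist_ball a" by (auto simp: S.ball_edges_def)
      then have "R l (et j) = S.level a l - l * ds (et j)" "R l (eh j) = S.level a l - l * ds (eh j)"
        using disj by (auto simp: R_def p_def q_def)
      then show ?thesis unfolding ball_edges_S(2)[OF ab' 1] by (simp add: right_diff_distrib)
    next
      case 2
      then have "et j \<in> T.dist_ball b" "eh j \<in> T.dist_ball b" by (auto simp: T.ball_edges_def)
      then have "R l (et j) = l * dt (et j) - T.level b l" "R l (eh j) = l * dt (eh j) - T.level b l"
        using disj by (auto simp: R_def p_def q_def)
      then show ?thesis unfolding ball_edges_T(2)[OF ab' 2] by (simp add: right_diff_distrib)
    qed
  qed
  have segment: "Q *v \<beta> l = demand - (\<chi> v. R l v)" "\<And>j. j \<notin> A \<Longrightarrow> \<beta> l $ j = 0"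
    "(\<forall>v. 0 \<le> p l v \<and> 0 \<le> q l v) \<Longrightarrow> 0 \<le> \<beta> l $ j * difference a b j" for l j
  proof -
    have p: "\<And>v. p l v \<noteq> 0 \<Longrightarrow> ds v \<le> a" "(\<Sum>v\<in>UNIV. p l v) = 1"
      using S.level_total[of a l] pos by (auto simp: p_def S.dist_ball_def split: if_splits)
    have q: "\<And>v. q l v \<noteq> 0 \<Longrightarrow> dt v \<le> b" "(\<Sum>v\<in>UNIV. q l v) = 1"
      using T.level_total[of b l] pos by (auto simp: q_def T.dist_ball_def split: if_splits)
    obtain x where x: "Q *v x = demand - (\<chi> v. R l v)" "\<And>j. x $ j \<noteq> 0 \<Longrightarrow> j \<in> tight (potential a b)"
      "(\<forall>v. 0 \<le> p l v \<and> 0 \<le> q l v) \<Longrightarrow> 0 \<le> x $ j * difference a b j" for j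
      using two_sided_flow[OF ab' p q] unfolding R_def by blast
    have "\<beta> l = x" unfolding \<beta>_def A_def sg_def
      by (rule segment_at[OF bp x(2) x(1)]) (use R_difference act in auto)
    then show "Q *v \<beta> l = demand - (\<chi> v. R l v)" "\<And>j. j \<notin> A \<Longrightarrow> \<beta> l $ j = 0"
      "(\<forall>v. 0 \<le> p l v \<and> 0 \<le> q l v) \<Longrightarrow> 0 \<le> \<beta> l $ j * difference a b j"
      using x act by auto
  qed
  have levels: "S.level a L = L * a" "T.level b L = L * b"
    using S.level_eq[OF pos(1) norm(1)] T.level_eq[OF pos(2) norm(2)] by auto
  have nonneg0: "0 \<le> p 0 v \<and> 0 \<le> q 0 v" for v by (auto simp: p_def q_def S.level_def T.level_def)
  have nonnegL: "0 \<le> p L v \<and> 0 \<le> q L v" for v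
    using L by (auto simp: p_def q_def levels S.dist_ball_def T.dist_ball_def)
  have cross: "cross_time Q demand A sg (lam S) j = 0" if "j \<in> A" for j
  proof -
    have "lam S = ereal L" using lam that by auto
    moreover have "cross_time Q demand A sg (ereal L) j = 0"
    proof (rule cross_time_eq_0)
      show "0 \<le> lars_a Q demand A $ j * difference a b j" using segment(3)[of 0 j] nonneg0
        by (simp add: \<beta>_def)
      show "0 \<le> (lars_a Q demand A - L *\<^sub>R lars_b Q A sg) $ j * difference a b j"
        using segment(3)[of L j] nonnegL unfolding \<beta>_def by blast
      show "difference a b j \<noteq> 0" using that act w_pos[of j] by (auto simp: tight_def)
    qed
    ultimately show ?thesis by simp
  qed
  define g where "g j l = column j Q \<bullet> (demand - active_columns Q A *v (lars_a Q demand A - l *\<^sub>R lars_b Q A sg))" for j l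
  have g: "g j l = (R l (et j) - R l (eh j)) / w j" for j l
  proof -
    have "g j l = column j Q \<bullet> (demand - Q *v \<beta> l)"
      using segment(2) by (simp add: g_def \<beta>_def[symmetric] active_columns_mult)
    then show ?thesis by (simp add: segment(1) column_inner)
  qed
  have RL: "R L v = L * potential a b v" for v
    using potential_S[OF ab', of v] potential_T[OF ab', of v] disj[of v]
    by (auto simp: R_def p_def q_def levels S.dist_ball_def T.dist_ball_def right_diff_distrib potential_def)
  have slack: "\<bar>g j l\<bar> < l" if j: "j \<notin> A" and l: "L \<le> l" "ereal l \<le> lam S" for j l
  proof -
    have gL: "\<bar>g j L\<bar> < L"
      using inactive_slack[OF L ab' j[unfolded act]] by (simp add: g RL right_diff_distrib)
    show ?thesis
    proof (cases "lam S = ereal L")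
      case True
      then show ?thesis using gL l by simp
    next
      case False
      \<comment> \<open>in the first iteration the signs vanish, so the correlations do not depend on \<open>\<lambda>\<close>\<close>
      then have "sg = 0" using lam by (simp add: sg vec_eq_iff)
      then have "g j l = g j L" by (simp add: g_def lars_b_def Let_def)
      then show ?thesis using gL l by simp
    qed
  qed
  define tj where "tj = join_time Q demand A sg (lam S)"
  have "ereal L \<le> lam S" using lam by auto
  note join_props = join_time_properties[where Q = Q and A = A and sg = sg
      and y = demand, OF L this,
      folded g_def, folded tj_def]
  have tj: "0 \<le> tj j" "tj j < L" "g j 0 \<noteq> 0 \<Longrightarrow> 0 < tj j" "0 < tj j \<Longrightarrow> \<bar>g j (tj j)\<bar> = tj j"
    "\<And>l. tj j < l \<Longrightarrow> l \<le> L \<Longrightarrow> \<bar>g j l\<bar> < l" if "j \<notin> A" for j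
    using join_props[of j] slack[OF that] by blast+
  define l where "l = Max (insert 0 (tj ` (- A)))"
  have tj_le: "tj j \<le> l" if "j \<notin> A" for j using that by (simp add: l_def)
  have l_L: "l < L" using tj(2) L by (simp add: l_def)
  \<comment> \<open>otherwise \<open>R 0\<close> would be constant on the connected network,
     but it is positive at \<open>s\<close> and negative at \<open>t\<close>\<close>
  have "\<exists>j. j \<notin> A \<and> g j 0 \<noteq> 0"
  proof (rule ccontr)
    assume "\<not> ?thesis"
    then have const: "R 0 (et j) = R 0 (eh j)" for j
      using g[of j 0] R_difference[of j 0] w_pos[of j] by (cases "j \<in> A") auto
    have "\<bar>R 0 t - R 0 s\<bar> \<le> 0 * ds t" by (rule S.lipschitz_bound) (simp add: const)
    then have "R 0 t = R 0 s" by simp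
    moreover have "s \<in> S.dist_ball a" "t \<in> T.dist_ball b" using S.root_in_ball T.root_in_ball pos
      by auto
    ultimately show False
      using disj[of s] disj[of t] S.card_ball[of a] T.card_ball[of b] pos
      by (simp add: R_def p_def q_def S.level_def T.level_def)
        (metis add_pos_pos eq_neg_iff_add_eq_0 inverse_positive_iff_positive inverse_eq_divide less_irrefl of_nat_0_less_iff)
  qed
  then obtain j0 where "j0 \<notin> A" "g j0 0 \<noteq> 0" by blast
  then have l0: "0 < l" using tj(3) tj_le by (meson less_le_trans)
  have "l \<in> insert 0 (tj ` (- A))" unfolding l_def by (rule Max_in) auto
  then obtain j1 where j1: "j1 \<notin> A" "tj j1 = l" using l0 by auto
  have bound: "\<bar>g j l\<bar> \<le> l" "\<bar>g j l\<bar> = l \<longleftrightarrow> tj j = l" if "j \<notin> A" for j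
    using tj(4)[OF that] tj(5)[OF that, of l] tj_le[OF that] l_L l0
    by (cases "tj j = l"; fastforce)+
  have activeg: "\<bar>g j l\<bar> = l" if "j \<in> A" for j
    using that l0 w_pos[of j] act by (auto simp: g R_difference tight_def abs_mult)
  have R_lip: "\<bar>R l (et j) - R l (eh j)\<bar> \<le> l * w j" for j
  proof -
    have "\<bar>g j l\<bar> \<le> l" using bound(1) activeg by (cases "j \<in> A") auto
    then show ?thesis using w_pos[of j] by (simp add: g divide_le_eq)
  qed
  define a' where "a' = S.level a l / l"
  define b' where "b' = T.level b l / l"
  have level': "S.level a l = l * a'" "T.level b l = l * b'" using l0 by (auto simp: a'_def b'_def)
  have a': "a < a'" using S.level_growth[OF pos(1) l0 l_L levels(1)] l0 by (simp add: level')
  have b': "b < b'" using T.level_growth[OF pos(2) l0 l_L levels(2)] l0 by (simp add: level')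
  have Rs: "R l s = l * a'" and Rt: "R l t = - (l * b')"
    using S.root_in_ball[of a] T.root_in_ball[of b] disj[of s] disj[of t] pos
    by (auto simp: R_def p_def q_def level' S.root T.root)
  have "\<bar>R l t - R l s\<bar> \<le> l * ds t" by (rule S.lipschitz_bound[OF R_lip])
  then have "l * (a' + b') \<le> l * ds t" using Rs Rt by (simp add: distrib_left)
  then have ab'': "a' + b' \<le> ds t" using l0 by simp
  \<comment> \<open>from \<open>s\<close>, where \<open>R l\<close> is \<open>l * a'\<close>, it falls to at most \<open>0\<close> outside the ball,
     which takes a distance of at least \<open>a'\<close>\<close>
  have outS: "a' \<le> ds v" if "v \<notin> S.dist_ball a" for v
  proof -
    have "q l v \<ge> 0" using l0 b' by (auto simp: q_def level' T.dist_ball_def)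
    then have "R l v \<le> 0" using that by (simp add: R_def p_def)
    moreover have "\<bar>R l v - R l s\<bar> \<le> l * ds v" by (rule S.lipschitz_bound[OF R_lip])
    ultimately have "l * a' \<le> l * ds v" using Rs by linarith
    then show ?thesis using l0 by simp
  qed
  have outT: "b' \<le> dt v" if "v \<notin> T.dist_ball b" for v
  proof -
    have "p l v \<ge> 0" using l0 a' by (auto simp: p_def level' S.dist_ball_def)
    then have "R l v \<ge> 0" using that by (simp add: R_def q_def)
    moreover have "\<bar>R l v - R l t\<bar> \<le> l * dt v" by (rule T.lipschitz_bound[OF R_lip])
    ultimately have "l * b' \<le> l * dt v" using Rt by linarith
    then show ?thesis using l0 by simp
  qed
  have pot: "R l v = l * potential a' b' v" for v
  proof -
    have "p l v = l * max 0 (a' - ds v)"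
      using outS[of v] a' by (auto simp: p_def level' S.dist_ball_def right_diff_distrib max_def)
    moreover have "q l v = l * max 0 (b' - dt v)"
      using outT[of v] b' by (auto simp: q_def level' T.dist_ball_def right_diff_distrib max_def)
    ultimately show ?thesis by (simp add: R_def potential_def right_diff_distrib)
  qed
  have g': "g j l = l * difference a' b' j / w j" for j by (simp add: g pot right_diff_distrib)
  have tight': "j \<in> tight (potential a' b') \<longleftrightarrow> \<bar>g j l\<bar> = l" for j
    using l0 w_pos[of j] by (simp add: g' tight_def abs_mult divide_eq_eq)
  define J where "J = {j \<in> - A. tj j = l}"
  let ?S = "lars_step Q demand S"
  have "0 < lam S" using lam L by auto
  then have step: "?S = \<lparr>lam = ereal l, active = A \<union> J,
      signs = (\<chi> j. if j \<in> J then sgn (g j l) else sg $ j)\<rparr>"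
    using lars_step_join(2)[of S Q demand] cross l0
    unfolding A_def[symmetric] sg_def[symmetric] tj_def[symmetric] l_def[symmetric] J_def[symmetric] g_def
    by simp
  have active': "A \<union> J = tight (potential a' b')"
    using tight' bound(2) activeg by (auto simp: J_def)
  have "(if j \<in> J then sgn (g j l) else sg $ j) = (if j \<in> A
    \<union> J then difference a' b' j / w j else 0)" for j
  proof -
    consider "j \<in> J" | "j \<in> A" "j \<notin> J" | "j \<notin> A" "j \<notin> J" by blast
    then show ?thesis
    proof cases
      case 1
      then have "\<bar>g j l\<bar> = l" using bound(2) by (auto simp: J_def)
      then have "l * sgn (g j l) = g j l" by (metis abs_mult_sgn)
      also have "\<dots> = l * (difference a' b' j / w j)" by (simp add: g')
      finally have "sgn (g j l) = difference a' b' j / w j" using l0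
        by (simp only: mult_left_cancel)
      then show ?thesis using 1 by simp
    next
      case 2
      then have "l * difference a b j = l * difference a' b' j" using R_difference[of j l]
        by (simp add: pot right_diff_distrib)
      then show ?thesis using 2 l0 by (simp add: sg)
    next
      case 3
      then show ?thesis by (simp add: sg)
    qed
  qed
  then have signs': "signs ?S = (\<chi> j. if j \<in> active ?S then difference a' b' j / w j else 0)"
    by (simp add: step vec_eq_iff)
  have "breakpoint ?S l a' b'"
    unfolding breakpoint_def
  proof (intro conjI)
    show "l * (\<Sum>v\<in>UNIV. max 0 (a' - ds v)) = 1"
      using pos a' by (intro S.level_normalized[of a]) (auto simp: level' outS)
    show "l * (\<Sum>v\<in>UNIV. max 0 (b' - dt v)) = 1"
      using pos b' by (intro T.level_normalized[of b]) (auto simp: level' outT)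
  qed (use l0 ab'' signs' active' in \<open>simp_all add: step\<close>)
  moreover have "active S \<subset> active ?S"
    using j1 by (auto simp: step A_def[symmetric] J_def)
  ultimately show ?thesis using a' b' step by (intro exI[of _ l] exI[of _ a'] exI[of _ b']) simp
qed

text \<open>
  Radii of a third of the smallest edge weight keep both balls trivial and no edge tight.
\<close>

lemma lars_init_breakpoint: "\<exists>L a b. breakpoint lars_init L a b \<and> a + b < ds t"
proof -
  define m where "m = Min (range w)"
  have m_le: "m \<le> w e" for e by (simp add: m_def)
  have "m \<in> range w" unfolding m_def by (rule Min_in) auto
  then have m: "0 < m" using w_pos by auto
  have far: "v \<noteq> s \<Longrightarrow> m \<le> ds v" "v \<noteq> t \<Longrightarrow> m \<le> dt v" for v
    using S.d_ge_min_weight T.d_ge_min_weight m_le by auto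
  let ?a = "m / 3"
  have ab: "?a + ?a < ds t" using far(1)[of t] neq m by simp
  have "max 0 (?a - ds v) = (if v = s then ?a else 0)" "max 0 (?a - dt v) =
    (if v = t then ?a else 0)" for v
    using far[of v] m S.root T.root by (auto simp: max_def)
  then have sums: "(\<Sum>v\<in>UNIV. max 0 (?a - ds v)) = ?a" "(\<Sum>v\<in>UNIV. max 0 (?a - dt v)) = ?a"
    by simp_all
  have "S.ball_edges ?a = {}" "T.ball_edges ?a = {}"
    using m_le m S.d_nonneg T.d_nonneg
    by (auto elim!: S.ball_edgesE T.ball_edgesE)
        (smt (verit) field_sum_of_halves divide_strict_left_mono)+
  then have "tight (potential ?a ?a) = {}" using tight_potential[OF ab] by simp
  then have "breakpoint lars_init (3 / m) ?a ?a"
    using m ab unfolding breakpoint_def sums by (simp add: lars_init_def vec_eq_iff)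
  then show ?thesis using ab by blast
qed

text \<open>
  The breakpoints are chosen successively while the balls are disjoint. The active sets increase
  strictly, so within as many steps as there are edges the radii add up to the distance of
  \<open>s\<close> and \<open>t\<close>.
\<close>

lemma lars_run:
  "\<exists>K\<ge>1. \<exists>L a b. (\<forall>k\<le>K. breakpoint (lars Q demand k) (L k) (a k) (b k)) \<and>
     (\<forall>k<K. a k + b k < ds t) \<and> a K + b K = ds t \<and> lam (lars Q demand K) = ereal (L K) \<and>
     (\<forall>k<K. a k \<le> a (Suc k) \<and> b k \<le> b (Suc k) \<and>
        active (lars Q demand k) \<subset> active (lars Q demand (Suc k)))"
proof -
  let ?X = "lars Q demand"
  have Suc: "?X (Suc k) = lars_step Q demand (?X k)" for k by (simp add: lars_def)
  define good where "good k x \<longleftrightarrow> (case x of (L, a, b) \<Rightarrow> breakpoint (?X k) L a b \<and> a + b < ds t)"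
    for k and x :: "real \<times> real \<times> real"
  define next_ok where "next_ok k x y \<longleftrightarrow> (case x of (L, a, b) \<Rightarrow> case y of (L', a', b') \<Rightarrow>
    breakpoint (?X (Suc k)) L' a' b' \<and> lam (?X (Suc k)) = ereal L' \<and> a \<le> a' \<and> b \<le> b' \<and>
    active (?X k) \<subset> active (?X (Suc k)))" for k and x y :: "real \<times> real \<times> real"
  have "\<exists>f. \<forall>k. (k = 0 \<longrightarrow> good k (f k)) \<and> (good k (f k) \<longrightarrow> next_ok k (f k) (f (Suc k)))"
  proof (rule dependent_nat_choice)
    show "\<exists>x. 0 = (0::nat) \<longrightarrow> good 0 x"
      using lars_init_breakpoint by (auto simp: good_def lars_def)
    show "\<exists>y. (Suc k = 0 \<longrightarrow> good (Suc k) y) \<and> (good k x \<longrightarrow> next_ok k x y)" for x k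
    proof (cases "good k x")
      case True
      then obtain L a b where "x = (L, a, b)" "breakpoint (?X k) L a b" "a + b < ds t"
        by (auto simp: good_def)
      then show ?thesis
        using lars_step_disconnected[of "?X k" L a b] by (auto simp: next_ok_def Suc)
    qed simp
  qed
  then obtain f where f0: "good 0 (f 0)" and f: "\<And>k. good k (f k) \<Longrightarrow> next_ok k (f k) (f (Suc k))"
    by blast
  have "\<exists>k. \<not> good k (f k)"
  proof (rule ccontr)
    assume "\<not> ?thesis"
    then have "active (?X k) \<subset> active (?X (Suc k))" for k
      using f[of k] by (auto simp: next_ok_def split: prod.splits)
    then have "k \<le> card (active (?X k))" for k
    proof (induction k)
      case (Suc k)
      then show ?case using psubset_card_mono[of "active (?X (Suc k))" "active (?X k)"] by fastforce
    qed simp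
    moreover have "card (active (?X k)) \<le> CARD('e)" for k by (simp add: card_mono)
    ultimately show False by (meson Suc_n_not_le_n order_trans)
  qed
  then obtain K where K: "\<not> good K (f K)" and least: "\<And>k. k < K \<Longrightarrow> good k (f k)"
    using exists_least_iff[of "\<lambda>k. \<not> good k (f k)"] by blast
  have "K \<noteq> 0" using f0 K by metis
  then obtain K' where K': "K = Suc K'" using not0_implies_Suc by blast
  define L where "L k = fst (f k)" for k
  define a where "a k = fst (snd (f k))" for k
  define b where "b k = snd (snd (f k))" for k
  have fk: "f k = (L k, a k, b k)" for k by (simp add: L_def a_def b_def)
  have below: "breakpoint (?X k) (L k) (a k) (b k)" "a k + b k < ds t" if "k < K" for k
    using least[OF that] by (auto simp: good_def fk)
  have step: "breakpoint (?X (Suc k)) (L (Suc k)) (a (Suc k)) (b (Suc k))"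
    "lam (?X (Suc k)) = ereal (L (Suc k))" "a k \<le> a (Suc k)" "b k \<le> b (Suc k)"
    "active (?X k) \<subset> active (?X (Suc k))" if "k < K" for k
    using f[OF least[OF that]] by (auto simp: next_ok_def fk)
  have bpK: "breakpoint (?X K) (L K) (a K) (b K)" and lamK: "lam (?X K) = ereal (L K)"
    using step(1,2)[of K'] K' by auto
  have "a K + b K = ds t" using K bpK by (auto simp: good_def fk breakpoint_def)
  moreover have "\<forall>k\<le>K. breakpoint (?X k) (L k) (a k) (b k)" using below(1) bpK by (metis le_less)
  ultimately show ?thesis using \<open>K \<noteq> 0\<close> below(2) lamK step(3-5)
    by (intro exI[of _ K] conjI exI[of _ L] exI[of _ a] exI[of _ b]) auto
qed

end

text \<open>
  If a ball contained a vertex besides its centre, the edge from it to its parent would be tight.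
  This identifies the initial trees.
\<close>

lemma (in two_rooted) empty_active_balls:
  assumes bp: "breakpoint S L a b" and empty: "active S = {}"
  shows "S.dist_ball a = {s}" "T.dist_ball b = {t}"
proof -
  have ab: "a + b \<le> ds t" and act: "tight (potential a b) = {}"
    using bp empty by (auto simp: breakpoint_def)
  note pos = breakpoint_pos[OF bp]
  have only: "v = s" if "v \<in> S.dist_ball a" for v
  proof (rule ccontr)
    assume "v \<noteq> s"
    then obtain e u where e: "ends e u v" "ds u + w e = ds v" using S.ex_parent by blast
    have "e \<in> S.ball_edges a" using that by (intro S.ball_edgesI[OF e]) (simp add: S.dist_ball_def)
    then show False using ball_edges_S(1)[OF ab] act by blast
  qed
  have "s \<in> S.dist_ball a" using S.root_in_ball[of a] pos by simp
  then show "S.dist_ball a = {s}" using only by blast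
  have only: "v = t" if "v \<in> T.dist_ball b" for v
  proof (rule ccontr)
    assume "v \<noteq> t"
    then obtain e u where e: "ends e u v" "dt u + w e = dt v" using T.ex_parent by blast
    have "e \<in> T.ball_edges b" using that by (intro T.ball_edgesI[OF e]) (simp add: T.dist_ball_def)
    then show False using ball_edges_T(1)[OF ab] act by blast
  qed
  have "t \<in> T.dist_ball b" using T.root_in_ball[of b] pos by simp
  then show "T.dist_ball b = {t}" using only by blast
qed

section \<open>Shortest paths of the graph\<close>

lemma ugraph_simps [simp]:
  "verts (ugraph et eh V E) = V" "arcs (ugraph et eh V E) = E \<times> UNIV"
  "tail (ugraph et eh V E) x = (if snd x then et (fst x) else eh (fst x))"
  "head (ugraph et eh V E) x = (if snd x then eh (fst x) else et (fst x))"
  by (auto simp: ugraph_def split: prod.splits)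

lemma wf_ugraph: "(\<And>e. e \<in> E \<Longrightarrow> et e \<in> V \<and> eh e \<in> V) \<Longrightarrow> wf_digraph (ugraph et eh V E)"
  by unfold_locales auto

lemma symmetric_ugraph: "symmetric (ugraph et eh V E)"
  unfolding symmetric_conv by force

lemma joins_arc: "joins et eh (fst x) (tail (ugraph et eh V E) x) (head (ugraph et eh V E) x)"
  by (auto simp: joins_def)

lemma arc_of_joins:
  assumes "joins et eh e u v"
  obtains b where "tail (ugraph et eh V E) (e, b) = u" "head (ugraph et eh V E) (e, b) = v"
  using assms by (auto simp: joins_def intro: that[of True] that[of False])

lemma adj_ugraph:
  assumes "joins et eh e u v" "e \<in> E"
  shows "u \<rightarrow>\<^bsub>ugraph et eh V E\<^esub> v"
proof -
  obtain b where b: "tail (ugraph et eh V E) (e, b) = u" "head (ugraph et eh V E) (e, b) = v"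
    using assms(1) by (rule arc_of_joins)
  show ?thesis
    unfolding arcs_ends_conv
  proof (rule image_eqI[where x = "(e, b)"])
    show "(u, v) = (tail (ugraph et eh V E) (e, b), head (ugraph et eh V E) (e, b))"
      by (simp only: b)
    show "(e, b) \<in> arcs (ugraph et eh V E)" using assms(2) by simp
  qed
qed

context weighted_network
begin

text \<open>
  The last edge of a shortest path to \<open>v\<close> leads to a parent of \<open>v\<close>. Conversely, the shortest path to
  a parent followed by the edge to \<open>v\<close> is again a simple path, since all vertices on the way to the
  parent are closer to the root than \<open>v\<close>. It is a shortest path to \<open>v\<close>, so uniqueness of shortest
  paths gives uniqueness of the parent edge.
\<close>

lemma shortest_paths_rooted_distance:
  defines "G \<equiv> ugraph et eh UNIV UNIV" and "c \<equiv> w \<circ> fst"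
  assumes unique: "\<And>v. \<exists>!p. shortest_path G c r p v"
  shows "\<exists>d. rooted_distance et eh w Q r d \<and>
    (\<forall>p v. pre_digraph.apath G r p v \<longrightarrow> wf_digraph.awalk_cost c p = d v \<longrightarrow> shortest_path G c r p v)"
proof -
  interpret G: wf_digraph G unfolding G_def by (rule wf_ugraph) simp
  define path where "path v = (THE p. shortest_path G c r p v)" for v
  define d where "d v = G.awalk_cost c (path v)" for v
  have path: "shortest_path G c r (path v) v" for v
    unfolding path_def by (rule theI') (rule unique)
  have c_pos: "0 < c x" for x using w_pos by (simp add: c_def)
  have cost_nonneg: "0 \<le> G.awalk_cost c p" for p
    unfolding G.awalk_cost_def using c_pos by (intro sum_list_nonneg) (auto simp: less_imp_le)
  have apath: "G.apath r (path v) v" for v using path[of v] by (simp add: shortest_path_def)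
  have d_le: "d v \<le> G.awalk_cost c p" if "G.apath r p v" for p v
    using path[of v] that by (simp add: shortest_path_def d_def)
  have shortest: "shortest_path G c r p v" if "G.apath r p v" "G.awalk_cost c p = d v" for p v
    unfolding shortest_path_def using that d_le[of _ v] by simp
  have on_path: "d x \<le> d u" if x: "x \<in> set (G.awalk_verts r (path u))" for x u
  proof -
    have "G.awalk r (path u) u" using apath by (rule G.awalkI_apath)
    then obtain q q' where q: "path u = q @ q'" "G.awalk r q x"
      using G.awalk_decomp x by blast
    have "G.apath r q x" using apath[of u] q by (simp add: G.apath_append_iff)
    then have "d x \<le> G.awalk_cost c q" by (rule d_le)
    then show ?thesis using cost_nonneg[of q'] by (simp add: d_def q)
  qed
  have extend: "G.apath r (path u @ [x]) v \<and> G.awalk_cost c (path u @ [x]) = d u + c x"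
    if x: "tail G x = u" "head G x = v" and new: "v \<notin> set (G.awalk_verts r (path u))" for u v x
  proof -
    have "G.awalk r (path u) u" using apath by (rule G.awalkI_apath)
    then have last: "last (G.awalk_verts r (path u)) = u" by blast
    then have "u \<in> set (G.awalk_verts r (path u))" by (metis G.awalk_verts_non_Nil last_in_set)
    then have "u \<noteq> v" using new by blast
    moreover have "u \<in> verts G" "v \<in> verts G" "x \<in> arcs G" by (simp_all add: G_def mem_Times_iff)
    ultimately have "G.apath u [x] v" using x by (simp add: G.apath_simps)
    then show ?thesis
      using apath[of u] last x new by (simp add: G.apath_append_iff d_def)
  qed
  have lip: "d v \<le> d u + w e" if e: "ends e u v" for e u v
  proof (cases "v \<in> set (G.awalk_verts r (path u))")
    case True
    then show ?thesis using on_path w_pos[of e] by (metis add.right_neutral add_mono less_imp_le)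
  next
    case False
    obtain b where "tail G (e, b) = u" "head G (e, b) = v" using arc_of_joins[OF e]
      unfolding G_def by blast
    from extend[OF this False] show ?thesis using d_le[of "path u @ [(e, b)]" v]
      by (simp add: c_def)
  qed
  have "rooted_distance et eh w Q r d"
  proof
    have "r \<in> verts G" by (simp add: G_def)
    then have "G.apath r [] r" by (simp add: G.apath_simps)
    then show "d r = 0" using d_le[of "[]" r] cost_nonneg[of "path r"] by (simp add: d_def)
    show "\<bar>d (et e) - d (eh e)\<bar> \<le> w e" for e
      using lip[OF ends_endpoints(1)[of e]] lip[OF ends_endpoints(2)[of e]]
      by (simp add: abs_le_iff)
    show "\<exists>e u. ends e u v \<and> d u + w e = d v" if "v \<noteq> r" for v
    proof -
      have "path v \<noteq> []" using apath[of v] that by (auto simp: G.apath_simps)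
      then obtain q x where q: "path v = q @ [x]" by (metis rev_exhaust)
      define u where "u = last (G.awalk_verts r q)"
      have "G.apath r q u" "tail G x = u" "head G x = v"
        using apath[of v] unfolding q G.apath_append_iff u_def by (auto simp: G.apath_simps)
      then have e: "ends (fst x) u v" "d u \<le> G.awalk_cost c q"
        using joins_arc[of et eh x UNIV UNIV] d_le unfolding G_def by auto
      then have "d u + w (fst x) \<le> d v" by (simp add: d_def q c_def)
      then show ?thesis using lip[OF e(1)] e(1) by force
    qed
    have edge_path: "\<exists>b. path u @ [(e, b)] = path v" if e: "ends e u v" "d u + w e = d v" for e u v
    proof -
      obtain b where b: "tail G (e, b) = u" "head G (e, b) = v" using arc_of_joins[OF e(1)]
        unfolding G_def by blast
      have "v \<notin> set (G.awalk_verts r (path u))" using on_path[of v u] e(2) w_pos[of e] by force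
      from extend[OF b this] have "shortest_path G c r (path u @ [(e, b)]) v"
        using e(2) by (intro shortest) (auto simp: c_def)
      then show ?thesis using unique path by blast
    qed
    show "e = e'" if "ends e u v" "d u + w e = d v" "ends e' u' v" "d u' + w e' = d v"
      for e u v e' u'
      using edge_path[OF that(1,2)] edge_path[OF that(3,4)] by (metis last_snoc prod.inject)
  qed
  then show ?thesis using shortest by blast
qed

end

context rooted_distance
begin

text \<open>
  Every edge of the ball leads either away from the root or towards it, always by its full
  weight. Since a vertex has only one edge towards the root, a walk that does not turn back on an
  edge continues to lead away once it has done so. A simple path from the root therefore
  leads away throughout and has the distance of its end as its length. A closed walk without
  repeated edges would have to start with the edge from its base point to the parent and to
  end with the same edge.
\<close>

lemma ball_shortest_path_tree:
  defines "G \<equiv> ugraph et eh UNIV UNIV" and "c \<equiv> w \<circ> fst"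
  assumes shortest: "\<And>p v. pre_digraph.apath G r p v \<Longrightarrow> wf_digraph.awalk_cost c p = d v \<Longrightarrow>
      shortest_path G c r p v"
    and a: "0 \<le> a"
  shows "shortest_path_tree G c r (ugraph et eh (dist_ball a) (ball_edges a))"
proof -
  define H where "H = ugraph et eh (dist_ball a) (ball_edges a)"
  interpret G: wf_digraph G unfolding G_def by (rule wf_ugraph) simp
  interpret H: wf_digraph H unfolding H_def by (rule wf_ugraph) (simp add: ball_edges_def)
  have c_pos: "0 < c x" for x using w_pos by (simp add: c_def)
  have sub: "subgraph H G"
    unfolding subgraph_def compatible_def
    using G.wf_digraph H.wf_digraph by (auto simp: H_def G_def)
  have joins_H: "ends (fst x) (tail H x) (head H x)" for x
    unfolding H_def by (rule joins_arc)
  define away where "away x \<longleftrightarrow> d (tail H x) + c x = d (head H x)" for x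
  define toward where "toward x \<longleftrightarrow> d (head H x) + c x = d (tail H x)" for x
  have not_both: "\<not> (away x \<and> toward x)" for x using c_pos[of x] by (auto simp: away_def toward_def)
  have direction: "away x \<or> toward x" if "x \<in> arcs H" for x
  proof -
    have "fst x \<in> tight d" using that by (auto simp: H_def ball_edges_def)
    then show ?thesis
      by (auto simp: tight_def away_def toward_def H_def c_def abs_if split: if_splits)
  qed
  have same_edge: "fst x = fst y" if "away x" "toward y" "head H x = tail H y" for x y
    using parent_unique[of "fst x" "tail H x" "head H x" "fst y" "head H y"] joins_H[of x] joins_H[of y] that
    by (simp add: away_def toward_def c_def ends_sym)
  have away_walk: "away x \<and> d u + G.awalk_cost c (x # p) = d v"
    if "H.awalk u (x # p) v" "distinct_adj (map fst (x # p))" "away x" for u x p v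
    using that
  proof (induction p arbitrary: u x)
    case Nil
    then show ?case by (auto simp: H.awalk_simps away_def)
  next
    case (Cons y p)
    have "away y"
      using Cons.prems same_edge[of x y] direction[of y] by (auto simp: H.awalk_simps)
    have step: "tail H x = u" "H.awalk (head H x) (y # p) v" "distinct_adj (map fst (y # p))"
      using Cons.prems by (auto simp: H.awalk_simps)
    have "d (head H x) + G.awalk_cost c (y # p) = d v"
      using Cons.IH[OF step(2,3) \<open>away y\<close>] by blast
    then show ?case using Cons.prems(3) step(1) by (simp add: away_def)
  qed
  have cost_nonneg: "0 \<le> G.awalk_cost c p" for p
    unfolding G.awalk_cost_def using c_pos by (intro sum_list_nonneg) (auto simp: less_imp_le)
  have toward_walk: "away (last p) \<or> d v < d u"
    if "H.awalk u p v" "distinct_adj (map fst p)" "p \<noteq> []" for u p v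
    using that
  proof (induction p arbitrary: u)
    case (Cons x p)
    have dir: "away x \<or> toward x" using Cons.prems direction by (auto simp: H.awalk_simps)
    have x: "tail H x = u" "H.awalk (head H x) p v" using Cons.prems by (auto simp: H.awalk_simps)
    show ?case
    proof (cases "p = []")
      case True
      then show ?thesis using dir x c_pos[of x] by (auto simp: H.awalk_simps toward_def)
    next
      case False
      then have IH: "away (last p) \<or> d v < d (head H x)"
        using Cons.IH[OF x(2)] Cons.prems(2) by (cases p) (auto simp: distinct_adj_Cons_Cons)
      show ?thesis
      proof (cases "away x")
        case True
        then have "d u + G.awalk_cost c (x # p) = d v" using away_walk Cons.prems by blast
        moreover have "d (head H x) = d u + c x" using True x by (simp add: away_def)
        ultimately have "d (head H x) \<le> d v" using cost_nonneg[of p] by simp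
        then show ?thesis using IH False by auto
      next
        case False
        then have "d (head H x) < d u" using dir x c_pos[of x] by (auto simp: toward_def)
        then show ?thesis using IH \<open>p \<noteq> []\<close> by auto
      qed
    qed
  qed simp
  have root_in_H: "r \<in> verts H" using root_in_ball[OF a] by (simp add: H_def)
  have acyclic: "\<not> (H.cycle p \<and> distinct (map fst p))" for p
  proof
    assume "H.cycle p \<and> distinct (map fst p)"
    then obtain u x q where p: "p = x # q" "H.awalk u p u" "distinct (map fst p)"
      unfolding H.cycle_def by (metis list.exhaust)
    then have adj: "distinct_adj (map fst p)"
      by (simp add: distinct_adj_altdef remdups_adj_distinct)
    have tail: "tail H x = u" and "x \<in> arcs H" using p by (auto simp: H.awalk_simps)
    have "\<not> away x"
    proof
      assume "away x"
      then have "d u + G.awalk_cost c p = d u" using away_walk p adj by blast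
      then show False using p(1) c_pos[of x] cost_nonneg[of q] by simp
    qed
    then have tw: "toward x" using direction \<open>x \<in> arcs H\<close> by blast
    have aw: "away (last p)" using toward_walk[OF p(2) adj] p(1) by auto
    have "last (H.awalk_verts u p) = u" using p(2) by (rule H.awlast_of_awalk) simp
    then have "head H (last p) = u" using p(1) by (simp add: H.awalk_verts_conv)
    then have "fst (last p) = fst x" using same_edge[OF aw tw] tail by simp
    then have "last p = x" using p(1,3) by (cases q rule: rev_cases) auto
    then show False using aw tw not_both by blast
  qed
  have reach: "v \<in> dist_ball a \<longrightarrow> r \<rightarrow>\<^sup>*\<^bsub>H\<^esub> v" for v
  proof (induction v rule: root_induct)
    case root
    show ?case using root_in_H by auto
  next
    case (step e u v)
    show ?case
    proof
      assume "v \<in> dist_ball a"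
      then have "e \<in> ball_edges a" "u \<in> dist_ball a"
        using step w_pos[of e] ball_edgesI[of e u v a] by (auto simp: dist_ball_def)
      then have "u \<rightarrow>\<^bsub>H\<^esub> v" using step(1) unfolding H_def by (intro adj_ugraph)
      then show "r \<rightarrow>\<^sup>*\<^bsub>H\<^esub> v" using step(3) \<open>u \<in> dist_ball a\<close> H.reachable_adj_trans by blast
    qed
  qed
  have "symmetric H" unfolding H_def by (rule symmetric_ugraph)
  then have conn: "strongly_connected H"
    unfolding strongly_connected_def
    using root_in_H reach symmetric_reachable H.reachable_trans by
        (metis H_def empty_iff ugraph_simps(1))
  have paths: "shortest_path G c r p v" if p: "H.apath r p v" for p v
  proof (rule shortest)
    show "G.apath r p v" using sub p by (rule G.subgraph_apath_imp_apath[rotated])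
    have adj: "distinct_adj (map fst p)" if "H.apath u p v" for u
      using that
    proof (induction p arbitrary: u)
      case (Cons x p)
      have rest: "H.apath (head H x) p v" using Cons.prems by (simp add: H.apath_simps)
      show ?case
      proof (cases p)
        case (Cons y q)
        have "fst x \<noteq> fst y"
        proof
          assume eq: "fst x = fst y"
          have xy: "head H x = tail H y" "tail H x \<notin> set (H.awalk_verts (head H x) p)"
            using Cons.prems Cons by (auto simp: H.apath_simps)
          moreover have "tail H x \<noteq> head H x"
            using loopfree[of "fst x"] by (auto simp: H_def)
          ultimately have "head H y = tail H x"
            using joins_H[of x] joins_H[of y] unfolding joins_def eq by metis
          moreover have "head H y \<in> set (H.awalk_verts (head H x) p)"
            by (rule H.awalk_verts_arc2[OF H.awalkI_apath[OF rest]]) (simp add: Cons)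
          ultimately show False using xy(2) by simp
        qed
        then show ?thesis using Cons.IH Cons.prems Cons by (auto simp: H.apath_simps)
      qed simp
    qed simp
    show "wf_digraph.awalk_cost c p = d v"
    proof (cases p)
      case Nil
      then show ?thesis using p root by (auto simp: H.apath_simps)
    next
      case (Cons x q)
      have "tail H x = r" "x \<in> arcs H" using p Cons by (auto simp: H.apath_simps)
      then have "away x"
        using direction[of x] d_nonneg[of "head H x"] c_pos[of x] by (auto simp: toward_def root)
      then have "d r + G.awalk_cost c p = d v"
        using away_walk[of r x q v] adj[OF p] H.awalkI_apath[OF p] Cons by blast
      then show ?thesis by (simp add: root)
    qed
  qed
  show ?thesis
    unfolding shortest_path_tree_def undirected_tree_def H_def[symmetric]
    using sub conn acyclic root_in_H paths by blast
qed

end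

text \<open>
  All edges of the shortest path from \<open>s\<close> to \<open>t\<close> are tight once the balls meet.
\<close>

lemma (in two_rooted) connected_at_meeting:
  assumes ab: "a + b = ds t"
  shows "s \<rightarrow>\<^sup>*\<^bsub>ugraph et eh UNIV (tight (potential a b))\<^esub> t"
proof -
  let ?H = "ugraph et eh UNIV (tight (potential a b))"
  interpret H: wf_digraph ?H by (rule wf_ugraph) simp
  have "ds v + dt v = ds t \<longrightarrow> s \<rightarrow>\<^sup>*\<^bsub>?H\<^esub> v" for v
  proof (induction v rule: S.root_induct)
    case root
    show ?case by (simp add: H.reachable_refl)
  next
    case (step e u v)
    show ?case
    proof
      assume v: "ds v + dt v = ds t"
      have "u \<rightarrow>\<^bsub>?H\<^esub> v" using step(1) geodesic_tight(1)[OF ab step(1,2) v] by (rule adj_ugraph)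
      moreover have "s \<rightarrow>\<^sup>*\<^bsub>?H\<^esub> u" using step(3) geodesic_tight(2)[OF ab step(1,2) v] by blast
      ultimately show "s \<rightarrow>\<^sup>*\<^bsub>?H\<^esub> v" by (rule H.reachable_adj_trans[rotated])
    qed
  qed
  then show ?thesis by (simp add: T.root)
qed

section \<open>The two shortest-path trees\<close>

theorem theorem8:
  fixes et eh :: "'e::finite \<Rightarrow> 'v::finite"
    and w :: "'e \<Rightarrow> real"
    and s t :: 'v
    and G :: "('v, 'e \<times> bool) pre_digraph"
    and c :: "'e \<times> bool \<Rightarrow> real"
    and Q :: "real ^ 'e ^ 'v"
    and y :: "real ^ 'v"
  assumes G_def: "G = ugraph et eh UNIV UNIV"
    and c_def: "c = w \<circ> fst"
    and Q_def: "Q = incidence_matrix et eh ** matrix_inv (diag_matrix w)"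
    and y_def: "y = pair_vector s t"
    and simple: "graph G"
    and conn: "strongly_connected G"
    and pos: "\<And>e. 0 < w e"
    and neq: "s \<noteq> t"
    and unique_s: "\<And>v. \<exists>!p. shortest_path G c s p v"
    and unique_t: "\<And>v. \<exists>!p. shortest_path G c t p v"
  shows "\<exists>K\<ge>1. \<exists>As At :: nat \<Rightarrow> 'e set. \<exists>Ts Tt :: nat \<Rightarrow> 'v set.
    (\<forall>k<K.
        active (lars Q y k) = As k \<union> At k \<and> As k \<inter> At k = {} \<and>
        Ts k \<inter> Tt k = {} \<and>
        shortest_path_tree G c s (ugraph et eh (Ts k) (As k)) \<and>
        shortest_path_tree G c t (ugraph et eh (Tt k) (At k))) \<and>
    active (lars Q y 0) = {} \<and> Ts 0 = {s} \<and> Tt 0 = {t} \<and>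
    (\<forall>k. Suc k < K \<longrightarrow> As k \<subseteq> As (Suc k) \<and> At k \<subseteq> At (Suc k)) \<and>
    (\<forall>k<K. active (lars Q y k) \<subset> active (lars Q y (Suc k))) \<and>
    s \<rightarrow>\<^sup>*\<^bsub>ugraph et eh UNIV (active (lars Q y K))\<^esub> t \<and>
    lam (lars Q y K) > 0 \<and> lam (lars Q y (Suc K)) = 0"
proof -
  interpret simple: graph G by (rule simple)
  interpret weighted_network et eh w Q
  proof
    show "et e \<noteq> eh e" for e using simple.no_loops[of "(e, True)"] by (simp add: G_def)
    show "Q $ i $ j = (if i = et j then 1 else if i = eh j then - 1 else 0) / w j" for i j
      unfolding Q_def by (rule weighted_incidence_nth)
          (use pos in \<open>simp add: less_imp_neq[symmetric]\<close>)
  qed (rule pos)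
  obtain ds where ds: "rooted_distance et eh w Q s ds"
    "\<And>p v. pre_digraph.apath G s p v \<Longrightarrow> wf_digraph.awalk_cost c p = ds v \<Longrightarrow> shortest_path G c s p v"
    using shortest_paths_rooted_distance[of s] unique_s unfolding G_def c_def by blast
  obtain dt where dt: "rooted_distance et eh w Q t dt"
    "\<And>p v. pre_digraph.apath G t p v \<Longrightarrow> wf_digraph.awalk_cost c p = dt v \<Longrightarrow> shortest_path G c t p v"
    using shortest_paths_rooted_distance[of t] unique_t unfolding G_def c_def by blast
  interpret two_rooted et eh w Q s t ds dt
    unfolding two_rooted_def two_rooted_axioms_def
    using ds(1) dt(1) neq weighted_network_axioms by blast
  have y: "y = demand"
    using neq by (auto simp: y_def pair_vector_def demand_def vec_eq_iff axis_def)
  let ?X = "lars Q y"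
  from lars_run[folded y] obtain K where "K \<ge> 1 \<and> (\<exists>L a b.
     (\<forall>k\<le>K. breakpoint (?X k) (L k) (a k) (b k)) \<and>
     (\<forall>k<K. a k + b k < ds t) \<and> a K + b K = ds t \<and> lam (?X K) = ereal (L K) \<and>
     (\<forall>k<K. a k \<le> a (Suc k) \<and> b k \<le> b (Suc k) \<and> active (?X k) \<subset> active (?X (Suc k))))"
    (is "_ \<and> ?run") ..
  then have K: "K \<ge> 1" and ?run by simp_all
  from \<open>?run\<close> obtain L a b where run: "\<forall>k\<le>K. breakpoint (?X k) (L k) (a k) (b k)"
     "\<forall>k<K. a k + b k < ds t" "a K + b K = ds t" "lam (?X K) = ereal (L K)"
     "\<forall>k<K. a k \<le> a (Suc k) \<and> b k \<le> b (Suc k) \<and> active (?X k) \<subset> active (?X (Suc k))"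
    by (elim exE conjE)
  have bp: "breakpoint (?X k) (L k) (a k) (b k)" if "k \<le> K" for k using run(1) that by blast
  have lt: "a k + b k < ds t" if "k < K" for k using run(2) that by blast
  note meet = run(3) and lamK = run(4)
  have mono: "a k \<le> a (Suc k)" "b k \<le> b (Suc k)"
    and grow: "active (?X k) \<subset> active (?X (Suc k))" if "k < K" for k
    using run(5) that by blast+
  have act: "active (?X k) = tight (potential (a k) (b k))" if "k \<le> K" for k
    using bp[OF that] by (simp add: breakpoint_def)
  have disj: "S.dist_ball (a k) \<inter> T.dist_ball (b k) = {}" if "k < K" for k
  proof -
    have "\<not> (ds v \<le> a k \<and> dt v \<le> b k)" for v using lt[OF that] triangle[of v] by linarith
    then show ?thesis by (auto simp: S.dist_ball_def T.dist_ball_def)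
  qed
  have trees: "shortest_path_tree G c s (ugraph et eh (S.dist_ball (a k)) (S.ball_edges (a k)))"
    "shortest_path_tree G c t (ugraph et eh (T.dist_ball (b k)) (T.ball_edges (b k)))" if "k \<le> K"
        for k
    unfolding G_def c_def
    using S.ball_shortest_path_tree[of "a k"] T.ball_shortest_path_tree[of "b k"] ds(2) dt(2)
      breakpoint_pos[OF bp[OF that]] unfolding G_def c_def by (simp_all add: less_imp_le)
  have init: "active (?X 0) = {}" by (simp add: lars_def lars_init_def)
  note balls = empty_active_balls[OF bp[of 0] init]
  show ?thesis
  proof (rule exI[of _ K], rule conjI, rule K, rule exI[of _ "\<lambda>k. S.ball_edges (a k)"],
      rule exI[of _ "\<lambda>k. T.ball_edges (b k)"], rule exI[of _ "\<lambda>k. S.dist_ball (a k)"],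
      rule exI[of _ "\<lambda>k. T.dist_ball (b k)"], intro conjI allI impI)
    show "s \<rightarrow>\<^sup>*\<^bsub>ugraph et eh UNIV (active (?X K))\<^esub> t"
      unfolding act[OF order_refl] by (rule connected_at_meeting[OF meet])
    show "lam (?X K) > 0" using bp[of K] lamK by (simp add: breakpoint_def)
    show "lam (?X (Suc K)) = 0"
      using lars_step_connected[OF bp[OF order_refl] lamK meet] unfolding y by (simp add: lars_def)
    show "active (?X k) = S.ball_edges (a k) \<union> T.ball_edges (b k)" if "k < K" for k
      using act[of k] tight_potential[OF lt[OF that]] that by simp
    show "S.ball_edges (a k) \<inter> T.ball_edges (b k) = {}" if "k < K" for k
      using disj[OF that] by (auto simp: S.ball_edges_def T.ball_edges_def)
  qed (use K disj trees init balls mono grow S.ball_edges_mono T.ball_edges_mono in \<open>simp_all\<close>)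
qed

end
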